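(* Let $(\mathcal{X},\|\cdot\|)$ be a separable $(2,D)$-smooth Banach space, $\mathcal{X}\neq\{0\}$, let $B>0$ and $\mu\in\mathcal{X}$, and let $X_1,X_2,\ldots$ be $\mathcal{X}$-valued random variables such that $$\mathbb{E}[X_{t+1}\mid\mathcal{F}_t]=\mu \quad\text{for all } t\ge 0,\qquad \|X_t\|\le B\quad\text{for all } t\ge 1,$$ where $\mathcal{F}_t=\sigma(X_1,\ldots,X_t)$ and $\mathcal{F}_0$ is trivial. Let $(\lambda_t)_{t\ge1}$ be any predictable sequence with values in $(0,0.8]$. Define $\psi_E(\lambda)=-\log(1-\lambda)-\lambda$, $\bar\mu_0=0$ and $\bar\mu_i=\frac{\sum_{j=1}^i\lambda_jX_j}{\sum_{j=1}^i\lambda_j}$ for $i\ge1$. Then for any $\alpha\in(0,1)$, with probability at least $1-\alpha$, simultaneously for all $t\ge1$, $$\left\|\frac{\sum_{i=1}^t\lambda_iX_i}{\sum_{i=1}^t\lambda_i}-\mu\right\|\le D\,\frac{\frac{1}{4B}\sum_{i=1}^t\psi_E(\lambda_i)\|X_i-\bar\mu_{i-1}\|^2+4B\log\frac{2}{\alpha}}{\sum_{i=1}^t\lambda_i}.$$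
   Context: A Banach space $(\mathcal{X},\|\cdot\|)$ is called $(2,D)$-smooth, for some $D>0$, if $\|x+y\|^2+\|x-y\|^2\le 2\|x\|^2+2D^2\|y\|^2$ for all $x,y\in\mathcal{X}$ (if $\mathcal{X}\ne\{0\}$ this forces $D\ge1$). A process $(\lambda_t)_{t\ge1}$ is predictable if $\lambda_t$ is $\mathcal{F}_{t-1}$-measurable for every $t$. Equalities and inequalities between random variables hold almost surely. *)

theory Defs
  imports "HOL-Probability.Probability"
begin

definition two_smooth :: "'a::real_normed_vector itself \<Rightarrow> real \<Rightarrow> bool" where
  "two_smooth TYPE('a) D \<longleftrightarrow> D > 0 \<and>
     (\<forall>x y :: 'a. (norm (x + y))\<^sup>2 + (norm (x - y))\<^sup>2 \<le> 2 * (norm x)\<^sup>2 + 2 * D\<^sup>2 * (norm y)\<^sup>2)"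

(* The natural filtration of a process indexed from 1: the member at t is generated by
   X 1, ..., X t, the one at 0 is trivial, and X 0 plays no role. *)
definition nat_filtration ::
  "'w measure \<Rightarrow> (nat \<Rightarrow> 'w \<Rightarrow> 'a::topological_space) \<Rightarrow> nat \<Rightarrow> 'w measure" where
  "nat_filtration M X t =
     sigma (space M) (\<Union>i\<in>{1..t}. {X i -` A \<inter> space M | A. A \<in> sets borel})"

(* Y is a version of the conditional expectation of the Banach-valued variable X given F;
   the library's real_cond_exp covers real-valued variables only. *)
definition is_cond_exp ::
  "'w measure \<Rightarrow> 'w measure \<Rightarrow> ('w \<Rightarrow> 'a::{banach, second_countable_topology}) \<Rightarrow> ('w \<Rightarrow> 'a) \<Rightarrow> bool"
where
  "is_cond_exp M F X Y \<longleftrightarrow> subalgebra M F \<and> integrable M X \<and> integrable M Y \<and>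
     Y \<in> borel_measurable F \<and>
     (\<forall>A\<in>sets F. set_lebesgue_integral M A X = set_lebesgue_integral M A Y)"

definition predictable ::
  "(nat \<Rightarrow> 'w measure) \<Rightarrow> (nat \<Rightarrow> 'w \<Rightarrow> 'a::topological_space) \<Rightarrow> bool" where
  "predictable F l \<longleftrightarrow> (\<forall>t\<ge>1. l t \<in> borel_measurable (F (t - 1)))"

definition psi_E :: "real \<Rightarrow> real" where
  "psi_E l = - ln (1 - l) - l"

definition running_mean ::
  "(nat \<Rightarrow> 'w \<Rightarrow> real) \<Rightarrow> (nat \<Rightarrow> 'w \<Rightarrow> 'a::real_vector) \<Rightarrow> nat \<Rightarrow> 'w \<Rightarrow> 'a" where
  "running_mean l X i w =
     (if i = 0 then 0 else (\<Sum>j=1..i. l j w *\<^sub>R X j w) /\<^sub>R (\<Sum>j=1..i. l j w))"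

end

(* The function G x = cosh (|x| / D) satisfies G (a + h) + G (a - h) <= 2 * G a * cosh |h| on a
   (2,D)-smooth space, because ln (cosh (sqrt u)) is concave.  Hence G is Gateaux differentiable
   and G (x + y) <= G x * (exp |y| - |y|) + G'(x) y, where G' may be integrated against a
   conditionally centred variable.  Put c = 1 / (4 * B), let S and V be the rescaled deviation
   sum_i c lam_i (X_i - mu) and the rescaled empirical variance, and expand around the S-value
   shifted by c lam (mu - running mean): the factor exp (- psi_E lam * c^2 |X - running mean|^2)
   absorbs the second-order term, so G(S) * exp(-V) is a supermartingale started at 1, to which
   Ville's maximal inequality applies. *)
theory Submission
  imports Defs "HOL-Real_Asymp.Real_Asymp"
begin

section \<open>Directional derivatives of convex functions\<close>

text \<open>The norm need not be differentiable at 0, but \<open>cosh\<close> is even, so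
  \<open>cosh\<close> of the norm is a smooth function of the squared norm, which is what smoothness
  of the space controls. No differentiability is postulated: the directional derivative is an
  infimum of difference quotients, and convexity together with the midpoint inequality makes it
  linear in the direction and continuous in the base point. Continuity is essential, because the
  base point is random and the gradient there has to be measurable and integrable against the
  increment.

  The obstacle is that the residual \<open>X i - running_mean lam X (i - 1)\<close> is observable
  but not conditionally centred, while \<open>X i - \<mu>\<close> is centred but does not occur in
  the bound. Convexity reconciles the two.

  The constant \<open>c = 1 / (4 * B)\<close> comes from residuals of norm at most
  \<open>2 * B\<close>: the rescaled ones have norm at most 1/2, the range in which the scalar
  inequality for \<open>psi_E\<close> is proved. The 2 in \<open>ln (2 / \<alpha>)\<close> is the
  price of replacing \<open>exp\<close> by \<open>2 * cosh\<close>, and the factor \<open>D\<close>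
  undoes the scaling inside \<open>cosh\<close>.\<close>

definition dir_deriv :: "('a::real_vector \<Rightarrow> real) \<Rightarrow> 'a \<Rightarrow> 'a \<Rightarrow> real" where
  "dir_deriv f x y = (INF t\<in>{0<..}. (f (x + t *\<^sub>R y) - f x) / t)"

lemma convex_slope_mono:
  assumes f: "convex_on UNIV f" and st: "0 < s" "s \<le> t"
  shows "(f (x + s *\<^sub>R y) - f x) / s \<le> (f (x + t *\<^sub>R y) - f x) / t"
proof -
  have "f ((1 - s / t) *\<^sub>R x + (s / t) *\<^sub>R (x + t *\<^sub>R y))
      \<le> (1 - s / t) * f x + (s / t) * f (x + t *\<^sub>R y)"
    by (rule convex_onD[OF f]) (use st in auto)
  moreover have "(1 - s / t) *\<^sub>R x + (s / t) *\<^sub>R (x + t *\<^sub>R y) = x + s *\<^sub>R y"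
    using st by (simp add: algebra_simps)
  ultimately have "f (x + s *\<^sub>R y) \<le> (1 - s / t) * f x + (s / t) * f (x + t *\<^sub>R y)"
    by simp
  then have "f (x + s *\<^sub>R y) - f x \<le> s * ((f (x + t *\<^sub>R y) - f x) / t)"
    by (simp add: algebra_simps diff_divide_distrib)
  then show ?thesis
    using st by (simp add: pos_divide_le_eq mult.commute)
qed

text \<open>\<open>x\<close> lies between \<open>x + t *\<^sub>R y\<close> and \<open>x - y\<close>,
  with weights \<open>1 / (1 + t)\<close> and \<open>t / (1 + t)\<close>. The resulting bound is
  free of \<open>t\<close>, so the infimum in \<open>dir_deriv\<close> runs over a set that is
  bounded below.\<close>

lemma convex_slope_lower:
  assumes f: "convex_on UNIV f" and t: "0 < t"
  shows "f x - f (x - y) \<le> (f (x + t *\<^sub>R y) - f x) / t"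
proof -
  have "f ((1 - t / (1 + t)) *\<^sub>R (x + t *\<^sub>R y) + (t / (1 + t)) *\<^sub>R (x - y))
      \<le> (1 - t / (1 + t)) * f (x + t *\<^sub>R y) + (t / (1 + t)) * f (x - y)"
    by (rule convex_onD[OF f]) (use t in \<open>auto simp: field_simps\<close>)
  moreover have e: "1 - t / (1 + t) = 1 / (1 + t)" using t by (simp add: field_simps)
  moreover have "(1 / (1 + t)) *\<^sub>R (x + t *\<^sub>R y) + (t / (1 + t)) *\<^sub>R (x - y)
      = (1 / (1 + t)) *\<^sub>R ((1 + t) *\<^sub>R x)"
    by (simp add: algebra_simps divide_inverse)
  moreover have "\<dots> = x" using t by simp
  ultimately have "f x \<le> (1 / (1 + t)) * f (x + t *\<^sub>R y) + (t / (1 + t)) * f (x - y)"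
    by (simp only:)
  then have "f x * (1 + t) \<le> f (x + t *\<^sub>R y) + t * f (x - y)"
    using t by (simp flip: add_divide_distrib add: pos_le_divide_eq)
  then show ?thesis using t by (simp add: field_simps)
qed

lemma dir_deriv_le_slope:
  assumes f: "convex_on UNIV f" and t: "0 < t"
  shows "dir_deriv f x y \<le> (f (x + t *\<^sub>R y) - f x) / t"
  unfolding dir_deriv_def
  by (rule cINF_lower) (use t convex_slope_lower[OF f] in \<open>auto intro!: bdd_belowI2\<close>)

lemma dir_deriv_gradient_ineq:
  assumes "convex_on UNIV f"
  shows "f x + dir_deriv f x y \<le> f (x + y)"
  using dir_deriv_le_slope[OF assms, of 1 x y] by simp

text \<open>Slopes shrink with \<open>t\<close>, so one slope below \<open>a\<close> settles all
  smaller steps; in the other direction the infimum bounds every slope from below.\<close>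

lemma dir_deriv_tendsto:
  assumes f: "convex_on UNIV f"
  shows "((\<lambda>t. (f (x + t *\<^sub>R y) - f x) / t) \<longlongrightarrow> dir_deriv f x y) (at_right 0)"
proof (rule order_tendstoI)
  fix a assume "a < dir_deriv f x y"
  then show "\<forall>\<^sub>F t in at_right 0. a < (f (x + t *\<^sub>R y) - f x) / t"
    unfolding eventually_at_right_field
    using dir_deriv_le_slope[OF f] by (intro exI[of _ 1]) (auto intro: less_le_trans)
next
  fix a assume "dir_deriv f x y < a"
  then obtain t where t: "0 < t" "(f (x + t *\<^sub>R y) - f x) / t < a"
    unfolding dir_deriv_def by (auto simp: cINF_less_iff intro!: bdd_belowI2 convex_slope_lower[OF f] dest!: cInf_lessD[rotated])
  then show "\<forall>\<^sub>F t in at_right 0. (f (x + t *\<^sub>R y) - f x) / t < a"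
    unfolding eventually_at_right_field
  proof (intro exI[of _ t] conjI allI impI)
    fix s assume "0 < s" "s < t"
    then show "(f (x + s *\<^sub>R y) - f x) / s < a"
      using convex_slope_mono[OF f, of s t x y] t by simp
  qed (use t in auto)
qed

text \<open>\<open>x + t *\<^sub>R (y + z)\<close> is the midpoint of
  \<open>x + (2 * t) *\<^sub>R y\<close> and \<open>x + (2 * t) *\<^sub>R z\<close>: the doubled
  step in each single direction compensates the factor 1/2 of convexity.\<close>

lemma dir_deriv_add_le:
  assumes f: "convex_on UNIV f"
  shows "dir_deriv f x (y + z) \<le> dir_deriv f x y + dir_deriv f x z"
proof (rule tendsto_le)
  show "\<forall>\<^sub>F t in at_right 0. (f (x + t *\<^sub>R (y + z)) - f x) / t
      \<le> (f (x + (2 * t) *\<^sub>R y) - f x) / (2 * t) + (f (x + (2 * t) *\<^sub>R z) - f x) / (2 * t)"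
    unfolding eventually_at_right_field
  proof (intro exI[of _ 1] conjI allI impI)
    fix t :: real assume t: "0 < t" "t < 1"
    have "f ((1 - 1/2) *\<^sub>R (x + (2 * t) *\<^sub>R y) + (1/2) *\<^sub>R (x + (2 * t) *\<^sub>R z))
        \<le> (1 - 1/2) * f (x + (2 * t) *\<^sub>R y) + (1/2) * f (x + (2 * t) *\<^sub>R z)"
      by (rule convex_onD[OF f]) auto
    moreover have "(1 - 1/2) *\<^sub>R (x + (2 * t) *\<^sub>R y) + (1/2) *\<^sub>R (x + (2 * t) *\<^sub>R z)
        = ((1/2) *\<^sub>R x + (1/2) *\<^sub>R x) + t *\<^sub>R (y + z)"
      by (simp add: algebra_simps)
    moreover have "\<dots> = x + t *\<^sub>R (y + z)"
      by (simp flip: scaleR_add_left)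
    ultimately have "f (x + t *\<^sub>R (y + z)) \<le> (f (x + (2 * t) *\<^sub>R y) + f (x + (2 * t) *\<^sub>R z)) / 2"
      by simp
    then show "(f (x + t *\<^sub>R (y + z)) - f x) / t
      \<le> (f (x + (2 * t) *\<^sub>R y) - f x) / (2 * t) + (f (x + (2 * t) *\<^sub>R z) - f x) / (2 * t)"
      using t by (simp add: divide_simps)
  qed auto
  have "filterlim (\<lambda>t::real. 2 * t) (at_right 0) (at_right 0)"
    by real_asymp
  note scale = filterlim_compose[OF dir_deriv_tendsto[OF f] this]
  show "((\<lambda>t. (f (x + (2 * t) *\<^sub>R y) - f x) / (2 * t) + (f (x + (2 * t) *\<^sub>R z) - f x) / (2 * t))
      \<longlongrightarrow> dir_deriv f x y + dir_deriv f x z) (at_right 0)"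
    by (intro tendsto_add scale)
qed (auto intro: dir_deriv_tendsto[OF f])

lemma dir_deriv_scaleR_pos:
  assumes f: "convex_on UNIV f" and c: "0 < c"
  shows "dir_deriv f x (c *\<^sub>R y) = c * dir_deriv f x y"
proof (rule tendsto_unique)
  show "((\<lambda>t. (f (x + t *\<^sub>R c *\<^sub>R y) - f x) / t) \<longlongrightarrow> dir_deriv f x (c *\<^sub>R y)) (at_right 0)"
    by (rule dir_deriv_tendsto[OF f])
  have "filterlim (\<lambda>t::real. t * c) (at_right 0) (at_right 0)"
    using c by real_asymp
  from filterlim_compose[OF dir_deriv_tendsto[OF f] this]
  have "((\<lambda>t. c * ((f (x + (t * c) *\<^sub>R y) - f x) / (t * c))) \<longlongrightarrow> c * dir_deriv f x y) (at_right 0)"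
    by (intro tendsto_mult tendsto_const)
  then show "((\<lambda>t. (f (x + t *\<^sub>R c *\<^sub>R y) - f x) / t) \<longlongrightarrow> c * dir_deriv f x y) (at_right 0)"
    using c by simp
qed auto

lemma dir_deriv_zero [simp]: "dir_deriv f x 0 = 0"
  by (simp add: dir_deriv_def)

text \<open>The derivative of a convex function is sublinear, hence linear as soon as it is odd.
  Subadditivity at \<open>y\<close> and \<open>- y\<close> already gives one half of oddness, so
  \<open>sym\<close> need only be an inequality.\<close>

lemma dir_deriv_linear:
  assumes f: "convex_on UNIV f"
    and sym: "\<And>y. dir_deriv f x y + dir_deriv f x (- y) \<le> 0"
  shows "linear (dir_deriv f x)"
proof -
  have neg: "dir_deriv f x (- y) = - dir_deriv f x y" for y
    using dir_deriv_add_le[OF f, of x y "- y"] sym[of y] by simp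
  have "dir_deriv f x (y + z) = dir_deriv f x y + dir_deriv f x z" for y z
    using dir_deriv_add_le[OF f, of x y z] dir_deriv_add_le[OF f, of x "- y" "- z"]
      neg[of "y + z"] by (simp add: neg)
  moreover have "dir_deriv f x (c *\<^sub>R y) = c * dir_deriv f x y" for c y
  proof -
    consider "c = 0" | "c > 0" | "c < 0" by linarith
    then show ?thesis
    proof cases
      case 3
      then show ?thesis
        using dir_deriv_scaleR_pos[OF f, of "- c" x y] neg[of "c *\<^sub>R y"] by simp
    qed (simp_all add: dir_deriv_scaleR_pos[OF f])
  qed
  ultimately show ?thesis by (intro linearI) auto
qed

text \<open>An infimum of continuous functions is upper semicontinuous, and antisymmetry in the
  direction turns this into continuity.\<close>

lemma dir_deriv_continuous_base:
  fixes f :: "'a::real_normed_vector \<Rightarrow> real"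
  assumes f: "convex_on UNIV f" and cont: "continuous_on UNIV f"
    and sym: "\<And>x y. dir_deriv f x y + dir_deriv f x (- y) \<le> 0"
    and X: "X \<longlonglongrightarrow> x"
  shows "(\<lambda>n. dir_deriv f (X n) y) \<longlonglongrightarrow> dir_deriv f x y"
proof -
  have neg: "dir_deriv f x (- y) = - dir_deriv f x y" for x y
    using dir_deriv_add_le[OF f, of x y "- y"] sym[of x y] by simp
  have upper: "\<forall>\<^sub>F n in sequentially. dir_deriv f (X n) y < a" if a: "dir_deriv f x y < a" for a y
  proof -
    have "\<forall>\<^sub>F t in at_right 0. (f (x + t *\<^sub>R y) - f x) / t < a"
      using dir_deriv_tendsto[OF f] a by (rule order_tendstoD)
    then have "\<exists>t>0. (f (x + t *\<^sub>R y) - f x) / t < a"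
      unfolding eventually_at_right_field using dense by blast
    then obtain t where t: "t > 0" "(f (x + t *\<^sub>R y) - f x) / t < a" by blast
    have "(\<lambda>n. (f (X n + t *\<^sub>R y) - f (X n)) / t) \<longlonglongrightarrow> (f (x + t *\<^sub>R y) - f x) / t"
      using t by (intro tendsto_intros continuous_on_tendsto_compose[OF cont] X) auto
    then have "\<forall>\<^sub>F n in sequentially. (f (X n + t *\<^sub>R y) - f (X n)) / t < a"
      using t by (intro order_tendstoD)
    then show ?thesis
      by eventually_elim (rule le_less_trans[OF dir_deriv_le_slope[OF f t(1)]])
  qed
  show ?thesis
  proof (rule order_tendstoI)
    fix a assume "a < dir_deriv f x y"
    then have "\<forall>\<^sub>F n in sequentially. dir_deriv f (X n) (- y) < - a"
      by (intro upper) (simp add: neg)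
    then show "\<forall>\<^sub>F n in sequentially. a < dir_deriv f (X n) y"
      by eventually_elim (simp add: neg)
  qed (rule upper)
qed

section \<open>The hyperbolic cosine of a smooth norm\<close>

lemma tanh_div_self_antimono:
  fixes x y :: real
  assumes xy: "0 < x" "x \<le> y"
  shows "tanh y / y \<le> tanh x / x"
proof (rule DERIV_nonpos_imp_nonincreasing[OF xy(2)])
  fix u :: real assume "x \<le> u" "u \<le> y"
  then have u: "u > 0" using xy by simp
  \<comment> \<open>Up to sign, the right-hand side is the numerator of the derivative of
    \<open>tanh u / u\<close>. It vanishes at 0 and is shown to be nondecreasing.\<close>
  have "0 - 0 * (1 - (tanh 0)\<^sup>2) \<le> tanh u - u * (1 - (tanh u)\<^sup>2)"
  proof -
    let ?h = "\<lambda>v::real. tanh v - v * (1 - (tanh v)\<^sup>2)"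
    have "?h 0 \<le> ?h u"
    proof (rule DERIV_nonneg_imp_nondecreasing[where f = ?h])
      show "0 \<le> u" using u by simp
    next
      fix v :: real assume v: "0 \<le> v" "v \<le> u"
      have "(tanh v)\<^sup>2 \<le> 1"
        using tanh_real_bounds[of v] by (auto simp: abs_square_le_1 abs_le_iff less_imp_le)
      then have "0 \<le> 2 * v * tanh v * (1 - (tanh v)\<^sup>2)"
        using v by (intro mult_nonneg_nonneg) auto
      moreover have "(?h has_real_derivative 2 * v * tanh v * (1 - (tanh v)\<^sup>2)) (at v)"
        by (rule derivative_eq_intros refl cosh_real_nonzero)+ (simp add: power2_eq_square algebra_simps)
      ultimately show "\<exists>y. (?h has_real_derivative y) (at v) \<and> 0 \<le> y"
        by (intro exI conjI)
    qed
    then show ?thesis by simp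
  qed
  then show "\<exists>l. ((\<lambda>v. tanh v / v) has_real_derivative l) (at u) \<and> l \<le> 0"
    using u by (intro exI[of _ "((1 - (tanh u)\<^sup>2) * u - tanh u) / (u * u)"])
      (auto intro!: derivative_eq_intros divide_nonpos_pos simp: algebra_simps)
qed

text \<open>That is, \<open>ln (cosh (sqrt u))\<close> is concave in \<open>u\<close>.\<close>

lemma cosh_mult_le_cosh_mult:
  fixes m d r k :: real
  assumes d: "0 \<le> d" "d \<le> r" "d \<le> k" and m: "0 \<le> m" and sq: "m\<^sup>2 + d\<^sup>2 \<le> r\<^sup>2 + k\<^sup>2"
  shows "cosh m * cosh d \<le> cosh r * cosh k"
proof -
  have *: "cosh m * cosh d \<le> cosh r * cosh k"
    if d: "d \<le> k" "k \<le> r" and sq: "m\<^sup>2 + d\<^sup>2 \<le> r\<^sup>2 + k\<^sup>2" for r k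
  proof -
    define \<sigma> where "\<sigma> = r\<^sup>2 + k\<^sup>2"
    \<comment> \<open>Two squares with fixed sum \<sigma>: as \<open>x\<close> grows from
      \<open>d\<^sup>2\<close> to \<open>k\<^sup>2\<close>, it stays below
      \<open>\<sigma> - x\<close>, so the two arguments move closer together and concavity raises
      \<open>F\<close>.\<close>
    define F where "F x = ln (cosh (sqrt x)) + ln (cosh (sqrt (\<sigma> - x)))" for x :: real
    have dk: "d\<^sup>2 \<le> k\<^sup>2" "k\<^sup>2 \<le> r\<^sup>2"
      using d assms(1) by (auto intro!: power_mono)
    have "F (d\<^sup>2) \<le> F (k\<^sup>2)"
    proof (rule DERIV_nonneg_imp_increasing_open[OF dk(1)])
      fix x assume "d\<^sup>2 < x" "x < k\<^sup>2"
      then have x: "0 < x" "x < \<sigma> - x"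
        using dk zero_le_power2[of d] by (linarith, simp add: \<sigma>_def)
      have "tanh (sqrt (\<sigma> - x)) / sqrt (\<sigma> - x) \<le> tanh (sqrt x) / sqrt x"
        using x by (intro tanh_div_self_antimono) auto
      then show "\<exists>y. (F has_real_derivative y) (at x) \<and> 0 \<le> y"
        unfolding F_def using x
        by (intro exI[of _ "(tanh (sqrt x) / sqrt x - tanh (sqrt (\<sigma> - x)) / sqrt (\<sigma> - x)) / 2"])
          (auto intro!: derivative_eq_intros simp: tanh_def divide_simps)
    next
      show "continuous_on {d\<^sup>2..k\<^sup>2} F"
        unfolding F_def by (intro continuous_intros) auto
    qed
    moreover have "F (d\<^sup>2) = ln (cosh d * cosh (sqrt (\<sigma> - d\<^sup>2)))"
      using assms(1) by (simp add: F_def ln_mult)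
    moreover have "F (k\<^sup>2) = ln (cosh k * cosh r)"
      using assms(1) d by (simp add: F_def \<sigma>_def ln_mult)
    ultimately have le: "cosh d * cosh (sqrt (\<sigma> - d\<^sup>2)) \<le> cosh k * cosh r"
      by simp
    have "cosh m \<le> cosh (sqrt (\<sigma> - d\<^sup>2))"
    proof -
      have "m \<le> sqrt (\<sigma> - d\<^sup>2)" using sq by (intro real_le_rsqrt) (simp add: \<sigma>_def)
      moreover from m this have "0 \<le> sqrt (\<sigma> - d\<^sup>2)" by (rule order_trans)
      ultimately show ?thesis using m by (simp only: cosh_real_nonneg_le_iff)
    qed
    then have "cosh m * cosh d \<le> cosh (sqrt (\<sigma> - d\<^sup>2)) * cosh d"
      by (rule mult_right_mono) simp
    also have "\<dots> \<le> cosh r * cosh k"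
      using le by (simp only: mult.commute)
    finally show ?thesis .
  qed
  show ?thesis
  proof (cases "k \<le> r")
    case False
    then show ?thesis using *[of r k] *[of k r] d sq by (simp add: mult.commute add.commute)
  qed (use * d sq in auto)
qed

text \<open>Only the position is divided by \<open>D\<close>. Dividing the smoothness inequality by
  \<open>D\<^sup>2\<close> then leaves the increment with coefficient 1, so that it can be measured
  by \<open>norm h\<close> unscaled.\<close>

definition cosh_norm :: "real \<Rightarrow> 'a::real_normed_vector \<Rightarrow> real" where
  "cosh_norm D x = cosh (norm x / D)"

lemma two_smooth_ge_1:
  assumes sm: "two_smooth TYPE('a::real_normed_vector) D" and ex: "\<exists>x::'a. x \<noteq> 0"
  shows "1 \<le> D"
proof -
  obtain y :: 'a where y: "y \<noteq> 0" using ex by blast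
  have "(norm (0 + y))\<^sup>2 + (norm (0 - y))\<^sup>2 \<le> 2 * (norm (0::'a))\<^sup>2 + 2 * D\<^sup>2 * (norm y)\<^sup>2"
    using sm unfolding two_smooth_def by blast
  then have "1 * (norm y)\<^sup>2 \<le> D\<^sup>2 * (norm y)\<^sup>2" by simp
  then have "1\<^sup>2 \<le> D\<^sup>2" using y by (simp only: mult_le_cancel_right) simp
  then show ?thesis
    using sm unfolding two_smooth_def by (intro power2_le_imp_le[of 1 D]) auto
qed

text \<open>For two reals with half-sum \<open>m\<close> and half-difference \<open>d\<close>, the
  sum of their \<open>cosh\<close> is \<open>2 * (cosh m * cosh d)\<close>, and the sum of their
  squares is \<open>2 * (m\<^sup>2 + d\<^sup>2)\<close>. Smoothness therefore gives the hypothesis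
  \<open>sq\<close> of the concavity lemma, and two triangle inequalities bound \<open>d\<close> by
  \<open>norm a / D\<close> and, as \<open>D\<close> is at least 1, by
  \<open>norm h\<close>.\<close>

lemma cosh_norm_midpoint_le:
  fixes a h :: "'a::real_normed_vector"
  assumes sm: "two_smooth TYPE('a) D" and D: "1 \<le> D"
  shows "cosh_norm D (a + h) + cosh_norm D (a - h) \<le> 2 * cosh_norm D a * cosh (norm h)"
proof -
  define p q where "p = norm (a + h) / D" and "q = norm (a - h) / D"
  define m d where "m = (p + q) / 2" and "d = \<bar>p - q\<bar> / 2"
  have pq: "0 \<le> p" "0 \<le> q" using D by (auto simp: p_def q_def)
  have "(norm (a + h))\<^sup>2 + (norm (a - h))\<^sup>2 \<le> 2 * (norm a)\<^sup>2 + 2 * D\<^sup>2 * (norm h)\<^sup>2"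
    using sm unfolding two_smooth_def by blast
  then have "((norm (a + h))\<^sup>2 + (norm (a - h))\<^sup>2) / D\<^sup>2
      \<le> (2 * (norm a)\<^sup>2 + 2 * D\<^sup>2 * (norm h)\<^sup>2) / D\<^sup>2"
    by (rule divide_right_mono) simp
  then have "p\<^sup>2 + q\<^sup>2 \<le> 2 * ((norm a / D)\<^sup>2 + (norm h)\<^sup>2)"
    using D by (simp add: p_def q_def power_divide add_divide_distrib)
  moreover have "p\<^sup>2 + q\<^sup>2 = 2 * (m\<^sup>2 + d\<^sup>2)"
  proof -
    have "4 * m\<^sup>2 = (p + q)\<^sup>2" "4 * d\<^sup>2 = (p - q)\<^sup>2"
      by (simp_all add: m_def d_def power_divide)
    then show ?thesis by (simp add: power2_sum power2_diff)
  qed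
  ultimately have sq: "m\<^sup>2 + d\<^sup>2 \<le> (norm a / D)\<^sup>2 + (norm h)\<^sup>2" by simp
  have diff: "\<bar>p - q\<bar> = \<bar>norm (a + h) - norm (a - h)\<bar> / D"
    using D by (simp add: p_def q_def diff_divide_distrib[symmetric])
  have "\<bar>norm (a + h) - norm (a - h)\<bar> \<le> 2 * norm a"
  proof -
    have "\<bar>norm (a + h) - norm (h - a)\<bar> \<le> norm ((a + h) - (h - a))" by (rule norm_triangle_ineq3)
    also have "(a + h) - (h - a) = 2 *\<^sub>R a" by (simp add: scaleR_2)
    finally show ?thesis by (simp add: norm_minus_commute)
  qed
  then have d1: "d \<le> norm a / D" using D by (simp add: d_def diff divide_simps)
  have "\<bar>norm (a + h) - norm (a - h)\<bar> \<le> norm ((a + h) - (a - h))" by (rule norm_triangle_ineq3)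
  also have "(a + h) - (a - h) = 2 *\<^sub>R h" by (simp add: scaleR_2)
  also have "norm \<dots> \<le> 2 * norm h * D" using D by (simp add: mult_le_cancel_left1)
  finally have d2: "d \<le> norm h" using D by (simp add: d_def diff divide_simps)
  have "cosh m * cosh d \<le> cosh (norm a / D) * cosh (norm h)"
    using pq by (intro cosh_mult_le_cosh_mult d1 d2 sq) (auto simp: m_def d_def)
  moreover have "cosh p + cosh q = 2 * (cosh m * cosh d)"
  proof -
    define e where "e = (p - q) / 2"
    have "cosh d = cosh e"
      unfolding d_def e_def using cosh_real_abs[of "(p - q) / 2"] by simp
    moreover have "p = m + e" "q = m - e" by (simp_all add: m_def e_def field_simps)
    ultimately show ?thesis by (simp add: cosh_add cosh_diff)
  qed
  ultimately show ?thesis by (simp add: cosh_norm_def p_def q_def)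
qed

lemma convex_on_cosh_norm:
  assumes "0 \<le> D"
  shows "convex_on UNIV (cosh_norm D :: 'a::real_normed_vector \<Rightarrow> real)"
proof (rule convex_onI)
  fix t :: real and x y :: 'a assume t: "0 < t" "t < 1"
  have "convex_on UNIV (cosh :: real \<Rightarrow> real)"
    by (rule f''_ge0_imp_convex[where f' = sinh and f'' = cosh])
      (auto intro!: derivative_eq_intros simp: less_imp_le cosh_real_pos)
  from convex_onD[OF this, of t "norm x / D" "norm y / D"] t
  have "cosh ((1 - t) * (norm x / D) + t * (norm y / D))
      \<le> (1 - t) * cosh (norm x / D) + t * cosh (norm y / D)" by simp
  moreover have "norm ((1 - t) *\<^sub>R x + t *\<^sub>R y) \<le> (1 - t) * norm x + t * norm y"
    using norm_triangle_ineq[of "(1 - t) *\<^sub>R x" "t *\<^sub>R y"] t by simp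
  then have "norm ((1 - t) *\<^sub>R x + t *\<^sub>R y) / D \<le> ((1 - t) * norm x + t * norm y) / D"
    using assms by (rule divide_right_mono)
  then have "cosh (norm ((1 - t) *\<^sub>R x + t *\<^sub>R y) / D)
      \<le> cosh ((1 - t) * (norm x / D) + t * (norm y / D))"
    using assms t by (subst cosh_real_nonneg_le_iff) (auto simp: add_divide_distrib)
  ultimately show "cosh_norm D ((1 - t) *\<^sub>R x + t *\<^sub>R y) \<le> (1 - t) * cosh_norm D x + t * cosh_norm D y"
    by (simp add: cosh_norm_def)
qed auto

lemma continuous_on_cosh_norm [continuous_intros]:
  "continuous_on S g \<Longrightarrow> continuous_on S (\<lambda>x. cosh_norm D (g x))"
  unfolding cosh_norm_def divide_inverse by (intro continuous_intros)

lemma cosh_norm_pos: "0 < cosh_norm D x"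
  by (simp add: cosh_norm_def cosh_real_pos)

text \<open>Here smoothness of the space turns into differentiability: the midpoint inequality
  bounds the second difference by a multiple of \<open>cosh (t * norm y) - 1\<close>, which is of
  order \<open>t\<^sup>2\<close> and still vanishes after division by \<open>t\<close>.\<close>

lemma dir_deriv_cosh_norm_sym:
  fixes x y :: "'a::real_normed_vector"
  assumes sm: "two_smooth TYPE('a) D" and D: "1 \<le> D"
  shows "dir_deriv (cosh_norm D) x y + dir_deriv (cosh_norm D) x (- y) \<le> 0"
proof (rule tendsto_le)
  have cv: "convex_on UNIV (cosh_norm D :: 'a \<Rightarrow> real)" using D by (intro convex_on_cosh_norm) simp
  show "((\<lambda>t. (cosh_norm D (x + t *\<^sub>R y) - cosh_norm D x) / t +
      (cosh_norm D (x + t *\<^sub>R - y) - cosh_norm D x) / t) \<longlongrightarrow>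
      dir_deriv (cosh_norm D) x y + dir_deriv (cosh_norm D) x (- y)) (at_right 0)"
    by (intro tendsto_add dir_deriv_tendsto cv)
  have "((\<lambda>t::real. (cosh (t * norm y) - 1) / t) \<longlongrightarrow> 0) (at_right 0)"
    by (cases "norm y = 0") (simp, real_asymp)
  then show "((\<lambda>t::real. 2 * cosh_norm D x * ((cosh (t * norm y) - 1) / t)) \<longlongrightarrow> 0) (at_right 0)"
    by (rule tendsto_mult_right_zero)
  show "\<forall>\<^sub>F t in at_right 0. (cosh_norm D (x + t *\<^sub>R y) - cosh_norm D x) / t +
      (cosh_norm D (x + t *\<^sub>R - y) - cosh_norm D x) / t
      \<le> 2 * cosh_norm D x * ((cosh (t * norm y) - 1) / t)"
    unfolding eventually_at_right_field
  proof (intro exI[of _ 1] conjI allI impI)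
    fix t :: real assume t: "0 < t" "t < 1"
    then show "(cosh_norm D (x + t *\<^sub>R y) - cosh_norm D x) / t +
      (cosh_norm D (x + t *\<^sub>R - y) - cosh_norm D x) / t
      \<le> 2 * cosh_norm D x * ((cosh (t * norm y) - 1) / t)"
      using divide_right_mono[OF cosh_norm_midpoint_le[OF sm D, of x "t *\<^sub>R y"], of t]
      by (simp add: diff_divide_distrib add_divide_distrib algebra_simps)
  qed auto
qed auto

lemma dir_deriv_cosh_norm_linear:
  fixes x :: "'a::real_normed_vector"
  assumes "two_smooth TYPE('a) D" "1 \<le> D"
  shows "linear (dir_deriv (cosh_norm D) x)"
  using assms by (intro dir_deriv_linear convex_on_cosh_norm dir_deriv_cosh_norm_sym) auto

text \<open>By the triangle inequality the function along the ray is dominated by the scalar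
  \<open>cosh (r + t * e)\<close>, which agrees with it at \<open>t = 0\<close> and has slope
  \<open>e * sinh r\<close> there. Linearity turns the one-sided bound into a two-sided one.\<close>

lemma abs_dir_deriv_cosh_norm_le:
  fixes x y :: "'a::real_normed_vector"
  assumes sm: "two_smooth TYPE('a) D" and D: "1 \<le> D"
  shows "\<bar>dir_deriv (cosh_norm D) x y\<bar> \<le> norm y * cosh_norm D x"
proof -
  have cv: "convex_on UNIV (cosh_norm D :: 'a \<Rightarrow> real)" using D by (intro convex_on_cosh_norm) simp
  have *: "dir_deriv (cosh_norm D) x y \<le> norm y * cosh_norm D x" for y
  proof -
    define r e where "r = norm x / D" and "e = norm y / D"
    have e: "0 \<le> e" "e \<le> norm y" using D by (auto simp: e_def divide_simps mult_le_cancel_left1)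
    have "dir_deriv (cosh_norm D) x y \<le> e * sinh r"
    proof (rule tendsto_le)
      show "((\<lambda>t. (cosh_norm D (x + t *\<^sub>R y) - cosh_norm D x) / t) \<longlongrightarrow> dir_deriv (cosh_norm D) x y) (at_right 0)"
        by (rule dir_deriv_tendsto[OF cv])
      have "((\<lambda>t. cosh (r + t * e)) has_real_derivative e * sinh r) (at 0)"
        by (auto intro!: derivative_eq_intros)
      then show "((\<lambda>t. (cosh (r + t * e) - cosh r) / t) \<longlongrightarrow> e * sinh r) (at_right 0)"
        by (auto simp: has_field_derivative_iff intro: filterlim_mono at_le)
      show "\<forall>\<^sub>F t in at_right 0. (cosh_norm D (x + t *\<^sub>R y) - cosh_norm D x) / t \<le> (cosh (r + t * e) - cosh r) / t"
        unfolding eventually_at_right_field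
      proof (intro exI[of _ 1] conjI allI impI)
        fix t :: real assume t: "0 < t" "t < 1"
        have "norm (x + t *\<^sub>R y) \<le> norm x + t * norm y"
          using norm_triangle_ineq[of x "t *\<^sub>R y"] t by simp
        then have "norm (x + t *\<^sub>R y) / D \<le> r + t * e"
          using D by (simp add: r_def e_def divide_simps)
        then have "cosh (norm (x + t *\<^sub>R y) / D) \<le> cosh (r + t * e)"
          using D by (intro cosh_real_nonneg_le_iff[THEN iffD2]) (auto intro: order_trans[rotated])
        then show "(cosh_norm D (x + t *\<^sub>R y) - cosh_norm D x) / t \<le> (cosh (r + t * e) - cosh r) / t"
          using t by (intro divide_right_mono) (auto simp: cosh_norm_def r_def)
      qed auto
    qed auto
    also have "\<dots> \<le> norm y * cosh r"
      using e D by (intro mult_mono) (auto simp: sinh_le_cosh_real r_def)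
    finally show ?thesis by (simp add: cosh_norm_def r_def)
  qed
  have "dir_deriv (cosh_norm D) x (- y) = - dir_deriv (cosh_norm D) x y"
    using dir_deriv_cosh_norm_linear[OF sm D] by (rule linear_neg)
  then show ?thesis using *[of y] *[of "- y"] by (simp add: abs_le_iff)
qed

lemma bounded_linear_dir_deriv_cosh_norm:
  fixes x :: "'a::real_normed_vector"
  assumes "two_smooth TYPE('a) D" "1 \<le> D"
  shows "bounded_linear (dir_deriv (cosh_norm D) x)"
  by (intro bounded_linear_intro[where K = "cosh_norm D x"])
    (auto simp: linear_add linear_scale dir_deriv_cosh_norm_linear[OF assms] abs_dir_deriv_cosh_norm_le[OF assms])

text \<open>The midpoint inequality makes
  \<open>q s = (cosh_norm D (x + s y) - cosh_norm D x * cosh (s |y|)) / sinh (s |y|)\<close> satisfy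
  \<open>q (2 s) \<le> q s\<close>, and \<open>q s\<close> tends to the directional derivative divided by \<open>|y|\<close>.\<close>

lemma cosh_norm_add_le:
  fixes x y :: "'a::real_normed_vector"
  assumes sm: "two_smooth TYPE('a) D" and D: "1 \<le> D"
  shows "cosh_norm D (x + y) \<le> cosh_norm D x * (exp (norm y) - norm y) + dir_deriv (cosh_norm D) x y"
proof (cases "y = 0")
  case False
  define k G l where "k = norm y" and "G = cosh_norm D x" and "l = dir_deriv (cosh_norm D) x y"
  have k: "k > 0" using False by (simp add: k_def)
  define g where "g s = cosh_norm D (x + s *\<^sub>R y)" for s
  define q where "q s = (g s - G * cosh (s * k)) / sinh (s * k)" for s
  have dbl: "q (2 * s) \<le> q s" if s: "s > 0" for s
  proof -
    \<comment> \<open>The midpoint inequality for the endpoints \<open>x\<close> and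
      \<open>x + (2 * s) *\<^sub>R y\<close>. Subtracting
      \<open>2 * G * (cosh (s * k))\<^sup>2\<close> from both sides produces
      \<open>cosh (2 * (s * k))\<close> on the left and a factor \<open>2 * cosh (s * k)\<close> on
      the right, which cancels against \<open>sinh_double\<close>.\<close>
    have "g (2 * s) + G \<le> 2 * g s * cosh (s * k)"
      using cosh_norm_midpoint_le[OF sm D, of "x + s *\<^sub>R y" "s *\<^sub>R y"] s
      by (simp add: g_def G_def k_def scaleR_2[symmetric] add.assoc)
    then have "g (2 * s) - G * cosh (2 * (s * k)) \<le> (g s - G * cosh (s * k)) * (2 * cosh (s * k))"
      unfolding cosh_double_cosh[of "s * k"] power2_eq_square
      by (simp add: algebra_simps del: cosh_real_pos)
    moreover have pos: "sinh (s * k) > 0" "cosh (s * k) > 0" using s k by (simp_all add: cosh_real_pos)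
    ultimately have "(g (2 * s) - G * cosh (2 * (s * k))) / (2 * sinh (s * k) * cosh (s * k))
        \<le> (g s - G * cosh (s * k)) * (2 * cosh (s * k)) / (2 * sinh (s * k) * cosh (s * k))"
      by (intro divide_right_mono) auto
    also have "\<dots> = q s" using pos by (simp add: q_def)
    finally show ?thesis by (simp add: q_def mult.assoc sinh_double)
  qed
  have q1: "q 1 \<le> q (1 / 2 ^ n)" for n
  proof (induction n)
    case (Suc n)
    have "q (1 / 2 ^ n) = q (2 * (1 / 2 ^ Suc n))" by simp
    also have "\<dots> \<le> q (1 / 2 ^ Suc n)" by (rule dbl) simp
    finally show ?case using Suc by simp
  qed simp
  have cv: "convex_on UNIV (cosh_norm D :: 'a \<Rightarrow> real)" using D by (intro convex_on_cosh_norm) simp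
  have "(q \<longlongrightarrow> l * inverse k - G * 0) (at_right 0)"
  proof (rule Lim_transform_eventually)
    have "((\<lambda>s::real. s / sinh (s * k)) \<longlongrightarrow> inverse k) (at_right 0)" using k by real_asymp
    moreover have "((\<lambda>s::real. (cosh (s * k) - 1) / sinh (s * k)) \<longlongrightarrow> 0) (at_right 0)" using k by real_asymp
    ultimately show "((\<lambda>s. (g s - G) / s * (s / sinh (s * k)) - G * ((cosh (s * k) - 1) / sinh (s * k)))
        \<longlongrightarrow> l * inverse k - G * 0) (at_right 0)"
      unfolding g_def G_def l_def by (intro tendsto_intros dir_deriv_tendsto cv)
    show "\<forall>\<^sub>F s in at_right 0. (g s - G) / s * (s / sinh (s * k)) - G * ((cosh (s * k) - 1) / sinh (s * k)) = q s"
      unfolding eventually_at_right_field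
      by (intro exI[of _ 1]) (auto simp: q_def diff_divide_distrib algebra_simps)
  qed
  moreover have "filterlim (\<lambda>n::nat. 1 / 2 ^ n :: real) (at_right 0) sequentially" by real_asymp
  ultimately have "(\<lambda>n. q (1 / 2 ^ n)) \<longlonglongrightarrow> l * inverse k - G * 0"
    by (rule filterlim_compose)
  then have "q 1 \<le> l / k"
    using LIMSEQ_le_const[of "\<lambda>n. q (1 / 2 ^ n)" _ "q 1"] q1 by (simp add: divide_inverse)
  then have "g 1 \<le> G * cosh k + l / k * sinh k"
    using k by (simp add: q_def pos_divide_le_eq)
  \<comment> \<open>The first-order term keeps its exact value \<open>l\<close>. Only the
    nonnegative excess \<open>sinh k - k\<close> is charged to \<open>G\<close>, and together with
    \<open>cosh k\<close> it makes up \<open>exp k - k\<close>.\<close>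
  also have "l / k * sinh k = l / k * (sinh k - k) + l" using k by (simp add: field_simps)
  also have "l / k * (sinh k - k) \<le> G * (sinh k - k)"
  proof (rule mult_right_mono)
    show "l / k \<le> G"
      using abs_dir_deriv_cosh_norm_le[OF sm D, of x y] k
      by (simp add: l_def k_def G_def pos_divide_le_eq mult.commute abs_le_iff)
    have "sinh 0 - 0 \<le> sinh k - k"
    proof (rule DERIV_nonneg_imp_nondecreasing[where f = "\<lambda>k. sinh k - k"])
      fix x :: real
      have "((\<lambda>k. sinh k - k) has_real_derivative cosh x - 1) (at x)"
        by (auto intro!: derivative_eq_intros)
      then show "\<exists>y. ((\<lambda>k. sinh k - k) has_real_derivative y) (at x) \<and> 0 \<le> y"
        using cosh_real_ge_1[of x] by force
    qed (use k in simp)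
    then show "0 \<le> sinh k - k" by simp
  qed
  finally have "g 1 \<le> G * (cosh k + sinh k - k) + l" by (simp add: algebra_simps)
  then show ?thesis by (simp add: g_def G_def l_def k_def cosh_plus_sinh)
qed (simp add: dir_deriv_def)

section \<open>The scalar inequality behind the empirical variance\<close>

lemma psi_E_nonneg:
  assumes "0 \<le> l" "l < 1"
  shows "0 \<le> psi_E l"
  using ln_le_minus_one[of "1 - l"] assms by (simp add: psi_E_def)

lemma psi_E_has_derivative:
  assumes "l < 1"
  shows "(psi_E has_real_derivative l / (1 - l)) (at l)"
proof -
  have "((\<lambda>l. - ln (1 - l) - l) has_real_derivative 1 / (1 - l) - 1) (at l)"
    using assms by (auto intro!: derivative_eq_intros)
  moreover have "1 / (1 - l) - 1 = l / (1 - l)" using assms by (simp add: field_simps)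
  ultimately show ?thesis unfolding psi_E_def[abs_def] by simp
qed

text \<open>The power series of \<open>psi_E\<close> has nonnegative coefficients and starts at
  order 2, so shrinking the argument by \<open>c\<close> gains at least \<open>c\<^sup>2\<close>.
  The proof compares derivatives instead of series.\<close>

lemma psi_E_scale_le:
  assumes c: "0 \<le> c" "c \<le> 1" and l: "0 \<le> l" "l < 1"
  shows "psi_E (c * l) \<le> c\<^sup>2 * psi_E l"
proof -
  define f where "f v = c\<^sup>2 * psi_E v - psi_E (c * v)" for v
  have "f 0 \<le> f l"
  proof (rule DERIV_nonneg_imp_nondecreasing[where f = f, OF l(1)])
    fix v assume v: "0 \<le> v" "v \<le> l"
    have cv: "c * v \<le> v" using c v by (simp add: mult_left_le_one_le)
    then have cv1: "c * v < 1" using v l by simp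
    have "(f has_real_derivative c\<^sup>2 * (v / (1 - v)) - c * v / (1 - c * v) * c) (at v)"
      unfolding f_def[abs_def] using v l
      by (intro DERIV_diff DERIV_cmult psi_E_has_derivative DERIV_chain2[of psi_E] cv1)
        (auto intro!: derivative_eq_intros)
    moreover have "c\<^sup>2 * (v / (1 - c * v)) \<le> c\<^sup>2 * (v / (1 - v))"
      using v l cv by (intro mult_left_mono divide_left_mono mult_pos_pos) auto
    ultimately show "\<exists>y. (f has_real_derivative y) (at v) \<and> 0 \<le> y"
      by (intro exI conjI) (assumption, simp add: power2_eq_square mult_ac)
  qed
  then show ?thesis by (simp add: f_def psi_E_def)
qed

text \<open>In logarithms: \<open>h\<close> vanishes at 0 and is nondecreasing. The constants 2 and
  1/4 make the leading terms agree, since \<open>psi_E (2 * a) / 4\<close> and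
  \<open>ln (exp a - 2 * a) - ln (1 - a)\<close> both start with
  \<open>a\<^sup>2 / 2\<close>.\<close>

lemma exp_mult_exp_psi_E_le:
  assumes a: "0 \<le> a" "a < 1/2"
  shows "(exp a - 2 * a) * exp (- (psi_E (2 * a) / 4)) \<le> 1 - a"
proof -
  define h where "h v = psi_E (2 * v) / 4 + (ln (1 - v) - ln (exp v - 2 * v))" for v
  have pos: "0 < exp v - 2 * v" "1 - v \<le> exp v - 2 * v" if "0 \<le> v" "v < 1/2" for v :: real
    using exp_ge_add_one_self[of v] that by linarith+
  have "h 0 \<le> h a"
  proof (rule DERIV_nonneg_imp_nondecreasing[where f = h, OF a(1)])
    fix v assume v: "0 \<le> v" "v \<le> a"
    define E where "E = exp v - 2 * v"
    have E: "0 < E" "1 - v \<le> E" using pos[of v] v a by (auto simp: E_def)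
    have "(h has_real_derivative (2 * v) / (1 - 2 * v) * 2 / 4 + (- 1 / (1 - v) - (exp v - 2) / E)) (at v)"
      unfolding h_def[abs_def]
    proof (intro DERIV_add DERIV_diff DERIV_cdivide DERIV_chain2[of psi_E] psi_E_has_derivative)
      show "((\<lambda>v. ln (1 - v)) has_real_derivative - 1 / (1 - v)) (at v)"
        using v a by (auto intro!: derivative_eq_intros)
      show "((\<lambda>v. ln (exp v - 2 * v)) has_real_derivative (exp v - 2) / E) (at v)"
        using E unfolding E_def by (auto intro!: derivative_eq_intros)
      show "((*) 2 has_real_derivative 2) (at v)" by (auto intro!: derivative_eq_intros)
    qed (use v a in auto)
    moreover have "0 \<le> (2 * v) / (1 - 2 * v) * 2 / 4 + (- 1 / (1 - v) - (exp v - 2) / E)"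
    proof -
      \<comment> \<open>Over the common denominator \<open>(1 - v) * E\<close>, the terms
        \<open>1 / (1 - v)\<close> and \<open>(exp v - 2) / E\<close> have numerator
        \<open>(2 - v) * exp v - 2\<close>; this is the bound of that numerator by
        \<open>v\<close>.\<close>
      have "(2 - v) * exp v \<le> 2 + v"
      proof -
        have "(2 + 0) - (2 - 0) * exp 0 \<le> (2 + v) - (2 - v) * exp v"
        proof (rule DERIV_nonneg_imp_nondecreasing[where f = "\<lambda>v. (2 + v) - (2 - v) * exp v", OF v(1)])
          fix u :: real assume u: "0 \<le> u" "u \<le> v"
          have "(1 - u) * exp u \<le> exp (- u) * exp u"
            using exp_ge_add_one_self[of "- u"] by (intro mult_right_mono) auto
          then have "(1 - u) * exp u \<le> 1" by (simp flip: exp_add)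
          moreover have "((\<lambda>v. (2 + v) - (2 - v) * exp v) has_real_derivative 1 - (1 - u) * exp u) (at u)"
            by (auto intro!: derivative_eq_intros simp: algebra_simps)
          ultimately show "\<exists>y. ((\<lambda>v. (2 + v) - (2 - v) * exp v) has_real_derivative y) (at u) \<and> 0 \<le> y"
            by (intro exI conjI) (assumption, simp)
        qed
        then show ?thesis by simp
      qed
      then have num: "E + (exp v - 2) * (1 - v) \<le> v" by (simp add: E_def algebra_simps)
      have "(1 - v) * (1 - v) \<le> (1 - v) * E" using E v a by (intro mult_left_mono) auto
      then have den: "1 - 2 * v \<le> (1 - v) * E" by (simp add: algebra_simps)
         (use zero_le_square[of v] in linarith)
      have "1 / (1 - v) + (exp v - 2) / E = (E + (exp v - 2) * (1 - v)) / ((1 - v) * E)"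
        using E v a by (simp add: add_frac_eq)
      also have "\<dots> \<le> v / ((1 - v) * E)"
        using num E v a by (intro divide_right_mono) auto
      also have "\<dots> \<le> v / (1 - 2 * v)"
        using den E v a by (intro divide_left_mono mult_pos_pos) auto
      also have "\<dots> = (2 * v) / (1 - 2 * v) * 2 / 4"
        using v a by (simp add: field_simps)
      finally show ?thesis unfolding minus_divide_left[symmetric] by linarith
    qed
    ultimately show "\<exists>y. (h has_real_derivative y) (at v) \<and> 0 \<le> y" by (intro exI conjI)
  qed
  then have "ln (exp a - 2 * a) + - (psi_E (2 * a) / 4) \<le> ln (1 - a)"
    by (simp add: h_def psi_E_def)
  then have "exp (ln (exp a - 2 * a) + - (psi_E (2 * a) / 4)) \<le> exp (ln (1 - a))" by simp
  then show ?thesis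
    unfolding exp_add using pos[OF a] a by simp
qed

text \<open>The damping factor is at most 1, so the worst case is \<open>\<rho> = - (l * k)\<close>,
  which is the previous lemma at \<open>a = l * k\<close>. Writing \<open>2 * a\<close> as
  \<open>(2 * k) * l\<close> with \<open>2 * k \<le> 1\<close> lets \<open>psi_E\<close> scale by
  \<open>(2 * k)\<^sup>2\<close>, and the 1/4 cancels the 4.\<close>

lemma exp_mult_exp_psi_E_add_le:
  assumes l: "0 < l" "l < 1" and k: "0 \<le> k" "k \<le> 1/2" and \<rho>: "- (l * k) \<le> \<rho>"
  shows "(exp (l * k) - l * k + \<rho>) * exp (- (psi_E l * k\<^sup>2)) \<le> 1 + \<rho>"
proof -
  have lk: "l * k < 1/2"
  proof (cases "k = 0")
    case False
    then have "l * k < 1 * k" using l k by (intro mult_strict_right_mono) auto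
    then show ?thesis using k by simp
  qed simp
  have "psi_E (2 * (l * k)) = psi_E (2 * k * l)" by (simp add: mult_ac)
  also have "\<dots> \<le> (2 * k)\<^sup>2 * psi_E l" using l k by (intro psi_E_scale_le) auto
  finally have "psi_E (2 * (l * k)) / 4 \<le> psi_E l * k\<^sup>2" by (simp add: power_mult_distrib mult_ac)
  then have "exp (- (psi_E l * k\<^sup>2)) \<le> exp (- (psi_E (2 * (l * k)) / 4))" by simp
  moreover have "0 \<le> exp (l * k) - 2 * (l * k)"
    using exp_ge_add_one_self[of "l * k"] lk by linarith
  ultimately have "(exp (l * k) - 2 * (l * k)) * exp (- (psi_E l * k\<^sup>2))
      \<le> (exp (l * k) - 2 * (l * k)) * exp (- (psi_E (2 * (l * k)) / 4))"
    by (rule mult_left_mono)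
  also have "\<dots> \<le> 1 - l * k" using l k lk by (intro exp_mult_exp_psi_E_le) auto
  finally have "(exp (l * k) - 2 * (l * k)) * exp (- (psi_E l * k\<^sup>2)) \<le> 1 - l * k" .
  moreover have "(l * k + \<rho>) * exp (- (psi_E l * k\<^sup>2)) \<le> (l * k + \<rho>) * 1"
    using \<rho> psi_E_nonneg[of l] l by (intro mult_left_mono) auto
  ultimately show ?thesis by (simp add: algebra_simps)
qed

text \<open>Division by \<open>cosh_norm D s\<close> leaves the scalar inequality, with \<rho> the
  relative slope; the derivative bound says exactly that \<rho> cannot fall below
  \<open>- (l * k)\<close>.\<close>

lemma cosh_norm_add_mult_exp_psi_E_le:
  fixes s x :: "'a::real_normed_vector"
  assumes sm: "two_smooth TYPE('a) D" and D: "1 \<le> D"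
    and l: "0 < l" "l < 1" and k: "0 \<le> k" "k \<le> 1/2" and x: "norm x = l * k"
  shows "cosh_norm D (s + x) * exp (- (psi_E l * k\<^sup>2))
    \<le> cosh_norm D s + dir_deriv (cosh_norm D) s x"
proof -
  define G \<rho> where "G = cosh_norm D s" and "\<rho> = dir_deriv (cosh_norm D) s x / G"
  have G: "G > 0" by (simp add: G_def cosh_norm_pos)
  have d: "dir_deriv (cosh_norm D) s x = G * \<rho>" using G by (simp add: \<rho>_def)
  have "- (l * k) \<le> \<rho>"
    using abs_dir_deriv_cosh_norm_le[OF sm D, of s x] G
    by (simp add: d x abs_mult G_def[symmetric] mult.commute[of "l * k"] abs_le_iff)
  have "cosh_norm D (s + x) \<le> G * (exp (l * k) - l * k + \<rho>)"
    using cosh_norm_add_le[OF sm D, of s x] by (simp add: d x G_def[symmetric] algebra_simps)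
  then have "cosh_norm D (s + x) * exp (- (psi_E l * k\<^sup>2))
      \<le> G * ((exp (l * k) - l * k + \<rho>) * exp (- (psi_E l * k\<^sup>2)))"
    by (simp add: mult.assoc[symmetric])
  also have "\<dots> \<le> G * (1 + \<rho>)"
    using G exp_mult_exp_psi_E_add_le[OF l k \<open>- (l * k) \<le> \<rho>\<close>] by simp
  finally show ?thesis by (simp add: d G_def algebra_simps)
qed

section \<open>Supermartingales\<close>

text \<open>The supermartingale property is required only in integrated form over sets of
  \<open>F n\<close>. This suffices because the event that no crossing has occurred by time
  \<open>n\<close> is such a set, so no stopped process is formed.\<close>

lemma supermartingale_maximal_ineq:
  fixes Z :: "nat \<Rightarrow> 'w \<Rightarrow> real"
  assumes "prob_space M"
    and sub: "\<And>n. subalgebra M (F n)" and mono: "\<And>n. sets (F n) \<subseteq> sets (F (Suc n))"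
    and Z: "\<And>n. Z n \<in> borel_measurable (F n)" "\<And>n. integrable M (Z n)" "\<And>n w. 0 \<le> Z n w"
    and step: "\<And>n A. A \<in> sets (F n) \<Longrightarrow>
      (\<integral>w. indicator A w * Z (Suc n) w \<partial>M) \<le> (\<integral>w. indicator A w * Z n w \<partial>M)"
    and c: "0 < c"
  shows "measure M {w \<in> space M. \<exists>n. c < Z n w} \<le> (\<integral>w. Z 0 w \<partial>M) / c"
proof -
  interpret prob_space M by fact
  define N where "N n = {w \<in> space M. \<forall>i\<le>n. Z i w \<le> c}" for n
  have mono': "sets (F i) \<subseteq> sets (F n)" if "i \<le> n" for i n
    using that by (induction rule: dec_induct) (use mono in blast)+
  have sp: "space (F n) = space M" for n using sub[of n] by (simp add: subalgebra_def)
  have NF: "N n \<in> sets (F n)" for n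
  proof -
    have "{w \<in> space (F n). Z i w \<le> c} \<in> sets (F n)" if "i \<le> n" for i
    proof -
      have "{w \<in> space (F i). Z i w \<le> c} \<in> sets (F i)" using Z(1)[of i] by measurable
      then show ?thesis using mono'[OF that] by (auto simp: sp)
    qed
    then have "(\<Inter>i\<in>{..n}. {w \<in> space (F n). Z i w \<le> c}) \<in> sets (F n)"
      by (intro sets.finite_INT) auto
    moreover have "(\<Inter>i\<in>{..n}. {w \<in> space (F n). Z i w \<le> c}) = N n"
      by (auto simp: N_def sp)
    ultimately show ?thesis by simp
  qed
  have NM [measurable]: "N n \<in> sets M" for n
    using NF[of n] sub[of n] by (auto simp: subalgebra_def)
  have intA: "integrable M (\<lambda>w. indicator A w * Z n w)" if "A \<in> sets M" for A n
    using integrable_mult_indicator[OF that Z(2)[of n]] by simp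
  \<comment> \<open>On \<open>A - N n\<close> the process exceeds \<open>c\<close>, so that part of
    the integral pays for \<open>c\<close> times its probability. The set \<open>A\<close> is
    \<open>space M\<close> at the start and the preceding \<open>N n\<close> in the
    induction.\<close>
  have split: "(\<integral>w. indicator (N n) w * Z n w \<partial>M) + c * measure M (A - N n)
      \<le> (\<integral>w. indicator A w * Z n w \<partial>M)"
    if A: "A \<in> sets M" and sub: "N n \<subseteq> A" "\<And>w. w \<in> A \<Longrightarrow> w \<notin> N n \<Longrightarrow> c < Z n w" for A n
  proof -
    have AN: "A - N n \<in> sets M" using A by simp
    have i: "integrable M (\<lambda>w. c * indicator (A - N n) w)"
    proof (rule integrable_const_bound[where B = c])
      show "AE w in M. norm (c * indicator (A - N n) w) \<le> c"
        using c by (auto simp: indicator_def)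
    qed (use AN in measurable)
    have "(\<integral>w. indicator (N n) w * Z n w \<partial>M) + c * measure M (A - N n)
        = (\<integral>w. indicator (N n) w * Z n w + c * indicator (A - N n) w \<partial>M)"
      using Bochner_Integration.integral_add[OF intA[OF NM] i] sets.sets_into_space[OF AN]
      by (simp add: Int_absorb2)
    also have "\<dots> \<le> (\<integral>w. indicator A w * Z n w \<partial>M)"
    proof (rule integral_mono)
      fix w assume "w \<in> space M"
      show "indicator (N n) w * Z n w + c * indicator (A - N n) w \<le> indicator A w * Z n w"
        using sub Z(3)[of n w] by (cases "w \<in> A"; cases "w \<in> N n") (auto simp: less_imp_le)
    qed (auto intro!: intA A i Bochner_Integration.integrable_add)
    finally show ?thesis .
  qed
  \<comment> \<open>Invariant: the mass still uncrossed plus \<open>c\<close> times the probability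
    of a crossing so far never exceeds the initial mean.\<close>
  have main: "(\<integral>w. indicator (N n) w * Z n w \<partial>M) + c * measure M (space M - N n) \<le> (\<integral>w. Z 0 w \<partial>M)" for n
  proof (induction n)
    case 0
    have "(\<integral>w. indicator (N 0) w * Z 0 w \<partial>M) + c * measure M (space M - N 0)
      \<le> (\<integral>w. indicator (space M) w * Z 0 w \<partial>M)"
      by (rule split) (auto simp: N_def)
    also have "\<dots> = (\<integral>w. Z 0 w \<partial>M)" by (rule Bochner_Integration.integral_cong) auto
    finally show ?case .
  next
    case (Suc n)
    have "(\<integral>w. indicator (N (Suc n)) w * Z (Suc n) w \<partial>M) + c * measure M (N n - N (Suc n))
      \<le> (\<integral>w. indicator (N n) w * Z (Suc n) w \<partial>M)"
    proof (rule split[OF NM])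
      show "N (Suc n) \<subseteq> N n" by (auto simp: N_def)
      fix w assume "w \<in> N n" "w \<notin> N (Suc n)"
      then show "c < Z (Suc n) w" by (fastforce simp: N_def le_Suc_eq)
    qed
    also have "\<dots> \<le> (\<integral>w. indicator (N n) w * Z n w \<partial>M)" by (rule step[OF NF])
    finally have "(\<integral>w. indicator (N (Suc n)) w * Z (Suc n) w \<partial>M) + c * measure M (N n - N (Suc n))
      + c * measure M (space M - N n) \<le> (\<integral>w. Z 0 w \<partial>M)" using Suc by simp
    moreover have "measure M (space M - N (Suc n)) = measure M (N n - N (Suc n)) + measure M (space M - N n)"
    proof -
      have "space M - N (Suc n) = (N n - N (Suc n)) \<union> (space M - N n)"
        by (auto simp: N_def)
      then show ?thesis by (simp add: finite_measure_Union[of "N n - N (Suc n)"] Int_Diff disjoint_iff)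
    qed
    ultimately show ?case by (simp add: algebra_simps)
  qed
  have bound: "measure M (space M - N n) \<le> (\<integral>w. Z 0 w \<partial>M) / c" for n
  proof -
    have "0 \<le> (\<integral>w. indicator (N n) w * Z n w \<partial>M)" using Z(3) by (intro integral_nonneg_AE) auto
    then show ?thesis using main[of n] c by (simp add: pos_le_divide_eq mult.commute)
  qed
  have "(\<lambda>n. measure M (space M - N n)) \<longlonglongrightarrow> measure M (\<Union>n. space M - N n)"
  proof (rule finite_Lim_measure_incseq)
    show "range (\<lambda>n. space M - N n) \<subseteq> sets M" using NM by auto
    show "incseq (\<lambda>n. space M - N n)" by (fastforce simp: N_def incseq_def)
  qed
  then have "measure M (\<Union>n. space M - N n) \<le> (\<integral>w. Z 0 w \<partial>M) / c"
    by (rule LIMSEQ_le_const2) (use bound in auto)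
  moreover have "(\<Union>n. space M - N n) = {w \<in> space M. \<exists>n. c < Z n w}"
    by (fastforce simp: N_def not_le)
  ultimately show ?thesis by simp
qed

section \<open>Gradients at random base points against a conditionally centred variable\<close>

text \<open>\<open>T\<close> commutes with the Bochner integral, so \<open>T (Y w - \<mu>)\<close>
  integrates to 0 over every set of \<open>F\<close>. Its real conditional expectation is therefore
  0, and the \<open>F\<close>-measurable weight \<phi> can be pulled out.\<close>

lemma is_cond_exp_integral_bounded_linear:
  fixes Y :: "'w \<Rightarrow> 'a::{banach, second_countable_topology}" and T :: "'a \<Rightarrow> real"
  assumes "prob_space M" and ce: "is_cond_exp M F Y (\<lambda>_. \<mu>)" and T: "bounded_linear T"
    and \<phi>: "\<phi> \<in> borel_measurable F" and int: "integrable M (\<lambda>w. \<phi> w * T (Y w - \<mu>))"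
  shows "(\<integral>w. \<phi> w * T (Y w - \<mu>) \<partial>M) = 0"
proof -
  interpret prob_space M by fact
  have sub: "subalgebra M F" and Y: "integrable M Y"
    and eq: "\<And>A. A \<in> sets F \<Longrightarrow> set_lebesgue_integral M A Y = set_lebesgue_integral M A (\<lambda>_. \<mu>)"
    using ce by (auto simp: is_cond_exp_def)
  interpret finite_measure_subalgebra M F by unfold_locales (rule sub)
  have Y\<mu>: "integrable M (\<lambda>w. Y w - \<mu>)" using Y by simp
  have TY: "integrable M (\<lambda>w. T (Y w - \<mu>))"
    by (rule integrable_bounded_linear[OF T Y\<mu>])
  have zero: "(LINT w:A|M. T (Y w - \<mu>)) = (LINT w:A|M. 0)" if A: "A \<in> sets F" for A
  proof -
    have AM: "A \<in> sets M" using A sub by (auto simp: subalgebra_def)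
    have si: "set_integrable M A Y" "set_integrable M A (\<lambda>_. \<mu>)"
      unfolding set_integrable_def
      by (intro integrable_mult_indicator[OF AM] Y, intro integrable_mult_indicator[OF AM]) simp
    have "(LINT w:A|M. T (Y w - \<mu>)) = (LINT w|M. T (indicator A w *\<^sub>R (Y w - \<mu>)))"
      using T by (simp add: set_lebesgue_integral_def linear_simps(5) bounded_linear.linear)
    also have "\<dots> = T (LINT w|M. indicator A w *\<^sub>R (Y w - \<mu>))"
      by (intro integral_bounded_linear[OF T] integrable_mult_indicator[OF AM Y\<mu>])
    also have "(LINT w|M. indicator A w *\<^sub>R (Y w - \<mu>)) = (LINT w:A|M. Y w) - (LINT w:A|M. \<mu>)"
      using set_integral_diff(2)[OF si] by (simp add: set_lebesgue_integral_def)
    also have "T \<dots> = 0" using eq[OF A] T by (simp add: linear_simps)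
    finally show ?thesis by (simp add: set_lebesgue_integral_def)
  qed
  have "AE w in M. real_cond_exp M F (\<lambda>w. T (Y w - \<mu>)) w = 0"
    by (rule real_cond_exp_charact) (use zero TY in auto)
  then have "(\<integral>w. \<phi> w * real_cond_exp M F (\<lambda>w. T (Y w - \<mu>)) w \<partial>M) = 0"
    by (intro integral_eq_zero_AE) auto
  then show ?thesis
    using real_cond_exp_intg(2)[OF int \<phi>] borel_measurable_integrable[OF TY] by simp
qed

text \<open>At a fixed base point measurability in \<open>Y\<close> is continuity of a bounded
  functional; a simple base point glues finitely many of these with indicators. General base points
  are reached by limits.\<close>

lemma measurable_dir_deriv_cosh_norm_simple:
  fixes Y :: "'w \<Rightarrow> 'a::{banach, second_countable_topology}"
  assumes sm: "two_smooth TYPE('a) D" and D: "1 \<le> D"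
    and s: "simple_function M s" and Y: "Y \<in> borel_measurable M"
  shows "(\<lambda>w. dir_deriv (cosh_norm D) (s w) (Y w)) \<in> borel_measurable M"
proof -
  have T: "dir_deriv (cosh_norm D) v \<in> borel_measurable borel" for v :: 'a
    using bounded_linear_dir_deriv_cosh_norm[OF sm D]
    by (intro borel_measurable_continuous_onI linear_continuous_on)
  have "(\<lambda>w. \<Sum>v\<in>s ` space M. indicator (s -` {v} \<inter> space M) w * dir_deriv (cosh_norm D) v (Y w))
      \<in> borel_measurable M"
    using simple_functionD(2)[OF s] measurable_compose[OF Y T]
    by (intro borel_measurable_sum borel_measurable_times borel_measurable_indicator) auto
  moreover have "(\<Sum>v\<in>s ` space M. indicator (s -` {v} \<inter> space M) w * dir_deriv (cosh_norm D) v (Y w))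
      = dir_deriv (cosh_norm D) (s w) (Y w)" if "w \<in> space M" for w
    using that simple_functionD(1)[OF s]
    by (subst sum.remove[of _ "s w"]) (auto intro!: sum.neutral simp: indicator_def)
  ultimately show ?thesis by (simp cong: measurable_cong)
qed

lemma dir_deriv_cosh_norm_tendsto:
  fixes x :: "'a::real_normed_vector"
  assumes "two_smooth TYPE('a) D" "1 \<le> D" "X \<longlonglongrightarrow> x"
  shows "(\<lambda>n. dir_deriv (cosh_norm D) (X n) y) \<longlonglongrightarrow> dir_deriv (cosh_norm D) x y"
  using assms by (intro dir_deriv_continuous_base convex_on_cosh_norm dir_deriv_cosh_norm_sym)
    (auto intro: continuous_intros)

lemma cosh_norm_mono:
  assumes "0 < D" "norm x \<le> r"
  shows "cosh_norm D x \<le> cosh (r / D)"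
proof -
  have "0 \<le> r" using assms(2) norm_ge_zero[of x] by linarith
  then show ?thesis
    using assms unfolding cosh_norm_def
    by (subst cosh_real_nonneg_le_iff) (auto simp: divide_right_mono)
qed

text \<open>On a level set of a simple base point the gradient is one fixed functional, and its
  weighted integral vanishes. Continuity of the gradient in the base point and dominated convergence
  carry this over to \<open>s\<close>.\<close>

lemma integral_dir_deriv_cosh_norm_eq_0:
  fixes Y s :: "'w \<Rightarrow> 'a::{banach, second_countable_topology}"
  assumes "prob_space M" and ce: "is_cond_exp M F Y (\<lambda>_. \<mu>)"
    and sm: "two_smooth TYPE('a) D" and D: "1 \<le> D"
    and s: "s \<in> borel_measurable F" and \<phi>: "\<phi> \<in> borel_measurable F"
    and sR: "AE w in M. norm (s w) \<le> R" and \<phi>C: "AE w in M. \<bar>\<phi> w\<bar> \<le> C"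
    and YB: "AE w in M. norm (Y w) \<le> B"
  shows "integrable M (\<lambda>w. \<phi> w * dir_deriv (cosh_norm D) (s w) (Y w - \<mu>))"
    and "(\<integral>w. \<phi> w * dir_deriv (cosh_norm D) (s w) (Y w - \<mu>) \<partial>M) = 0"
proof -
  interpret prob_space M by fact
  have sub: "subalgebra M F" and Y: "integrable M Y" using ce by (auto simp: is_cond_exp_def)
  have sp: "space F = space M" using sub by (simp add: subalgebra_def)
  let ?d = "dir_deriv (cosh_norm D) :: 'a \<Rightarrow> 'a \<Rightarrow> real"
  note bl = bounded_linear_dir_deriv_cosh_norm[OF sm D]
  have Y\<mu> [measurable]: "(\<lambda>w. Y w - \<mu>) \<in> borel_measurable M"
    using borel_measurable_integrable[OF Y] by simp
  note [measurable] = measurable_from_subalg[OF sub \<phi>]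
  obtain S where S: "\<And>i. simple_function F (S i)" "\<And>w. w \<in> space M \<Longrightarrow> (\<lambda>i. S i w) \<longlonglongrightarrow> s w"
      "\<And>i w. w \<in> space M \<Longrightarrow> dist (S i w) 0 \<le> 2 * dist (s w) 0"
    using borel_measurable_implies_sequence_metric[OF s, of 0] unfolding sp by blast
  have SM: "simple_function M (S i)" for i
    using S(1)[of i] sub by (auto simp: simple_function_def subalgebra_def)
  \<comment> \<open>The radius is \<open>2 * R\<close> because the simple approximations are
    controlled only by twice the norm of \<open>s\<close>.\<close>
  define K where "K = C * ((B + norm \<mu>) * cosh (2 * R / D))"
  have bound: "\<bar>\<phi> w * ?d v (Y w - \<mu>)\<bar> \<le> K"
    if "norm v \<le> 2 * R" "\<bar>\<phi> w\<bar> \<le> C" "norm (Y w) \<le> B" for w v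
  proof -
    have "\<bar>?d v (Y w - \<mu>)\<bar> \<le> norm (Y w - \<mu>) * cosh_norm D v"
      by (rule abs_dir_deriv_cosh_norm_le[OF sm D])
    also have "\<dots> \<le> (B + norm \<mu>) * cosh (2 * R / D)"
      using that D norm_triangle_ineq4[of "Y w" \<mu>] order_trans[OF norm_ge_zero that(3)]
      by (intro mult_mono cosh_norm_mono) (auto simp: less_imp_le cosh_norm_pos)
    finally show ?thesis unfolding abs_mult K_def
      using that by (intro mult_mono) auto
  qed
  have boundS: "AE w in M. norm (\<phi> w * ?d (S i w) (Y w - \<mu>)) \<le> K" for i
    using sR \<phi>C YB AE_space
  proof eventually_elim
    case (elim w)
    then show ?case using bound[of "S i w" w] S(3)[of w i] by simp
  qed
  have bound_s: "AE w in M. norm (\<phi> w * ?d (s w) (Y w - \<mu>)) \<le> K"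
    using sR \<phi>C YB
  proof eventually_elim
    case (elim w)
    then have "norm (s w) \<le> 2 * R" using norm_ge_zero[of "s w"] by linarith
    then show ?case using bound[of "s w" w] elim by simp
  qed
  have meas_S: "(\<lambda>w. \<phi> w * ?d (S i w) (Y w - \<mu>)) \<in> borel_measurable M" for i
    using measurable_dir_deriv_cosh_norm_simple[OF sm D SM Y\<mu>] by measurable
  have lim: "(\<lambda>i. \<phi> w * ?d (S i w) (Y w - \<mu>)) \<longlonglongrightarrow> \<phi> w * ?d (s w) (Y w - \<mu>)" if "w \<in> space M" for w
    by (intro tendsto_mult tendsto_const dir_deriv_cosh_norm_tendsto[OF sm D] S(2) that)
  have meas_s: "(\<lambda>w. \<phi> w * ?d (s w) (Y w - \<mu>)) \<in> borel_measurable M"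
    by (rule borel_measurable_LIMSEQ_real[OF lim meas_S])
  show "integrable M (\<lambda>w. \<phi> w * ?d (s w) (Y w - \<mu>))"
    by (rule integrable_const_bound[OF bound_s meas_s])
  have zero: "(\<integral>w. \<phi> w * ?d (S i w) (Y w - \<mu>) \<partial>M) = 0" for i
  proof -
    define J where "J v = S i -` {v} \<inter> space M" for v
    have J: "J v \<in> sets F" for v using simple_functionD(2)[OF S(1)] by (simp add: J_def sp)
    have JM: "J v \<in> sets M" for v using J sub by (auto simp: subalgebra_def)
    have fin: "finite (S i ` space M)" using simple_functionD(1)[OF SM] .
    have int: "integrable M (\<lambda>w. indicator (J v) w * \<phi> w * ?d v (Y w - \<mu>))" for v
    proof -
      have eq: "indicator (J v) w * \<phi> w * ?d v (Y w - \<mu>) = indicator (J v) w * (\<phi> w * ?d (S i w) (Y w - \<mu>))" for w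
        by (auto simp: J_def indicator_def)
      show ?thesis unfolding eq
        using integrable_mult_indicator[OF JM integrable_const_bound[OF boundS meas_S]] by simp
    qed
    have "(\<integral>w. \<phi> w * ?d (S i w) (Y w - \<mu>) \<partial>M)
        = (\<integral>w. (\<Sum>v\<in>S i ` space M. indicator (J v) w * \<phi> w * ?d v (Y w - \<mu>)) \<partial>M)"
    proof (rule Bochner_Integration.integral_cong[OF refl])
      fix w assume "w \<in> space M"
      then show "\<phi> w * ?d (S i w) (Y w - \<mu>) = (\<Sum>v\<in>S i ` space M. indicator (J v) w * \<phi> w * ?d v (Y w - \<mu>))"
        using fin by (subst sum.remove[of _ "S i w"]) (auto intro!: sum.neutral simp: indicator_def J_def)
    qed
    also have "\<dots> = (\<Sum>v\<in>S i ` space M. \<integral>w. indicator (J v) w * \<phi> w * ?d v (Y w - \<mu>) \<partial>M)"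
      by (rule Bochner_Integration.integral_sum) (rule int)
    also have "\<dots> = 0"
    proof (rule sum.neutral, rule ballI)
      fix v
      have "(\<lambda>w. indicator (J v) w * \<phi> w) \<in> borel_measurable F"
        using J \<phi> by (intro borel_measurable_times borel_measurable_indicator)
      then show "(\<integral>w. indicator (J v) w * \<phi> w * ?d v (Y w - \<mu>) \<partial>M) = 0"
        by (rule is_cond_exp_integral_bounded_linear[OF assms(1) ce bl _ int])
    qed
    finally show ?thesis .
  qed
  have "(\<lambda>i. \<integral>w. \<phi> w * ?d (S i w) (Y w - \<mu>) \<partial>M) \<longlonglongrightarrow> (\<integral>w. \<phi> w * ?d (s w) (Y w - \<mu>) \<partial>M)"
    by (rule integral_dominated_convergence[where w = "\<lambda>_. K", OF meas_s meas_S _ AE_I2[OF lim] boundS])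
      simp_all
  then show "(\<integral>w. \<phi> w * ?d (s w) (Y w - \<mu>) \<partial>M) = 0"
    by (simp add: zero LIMSEQ_const_iff)
qed

section \<open>One step of the supermartingale\<close>

lemma borel_measurable_psi_E [measurable]: "psi_E \<in> borel_measurable borel"
  unfolding psi_E_def[abs_def] by measurable

lemma borel_measurable_cosh_norm [measurable]:
  "cosh_norm D \<in> borel_measurable (borel :: 'a::real_normed_vector measure)"
  by (intro borel_measurable_continuous_onI continuous_intros)

text \<open>With \<open>m\<close> predicting \<open>Y\<close>, the expansion is made around \<open>s' = s - c l (\<mu> - m)\<close>; the gradient
  inequality at \<open>s'\<close> brings the base point back to \<open>s\<close>, so only \<open>Y - m\<close> enters the exponent.\<close>

lemma cosh_norm_supermartingale_step:
  fixes Y s m :: "'w \<Rightarrow> 'a::{banach, second_countable_topology}" and l V :: "'w \<Rightarrow> real"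
  assumes "prob_space M" and ce: "is_cond_exp M F Y (\<lambda>_. \<mu>)"
    and sm: "two_smooth TYPE('a) D" and D: "1 \<le> D" and B: "0 < B"
    and s: "s \<in> borel_measurable F" and m: "m \<in> borel_measurable F"
    and l: "l \<in> borel_measurable F" and V: "V \<in> borel_measurable F" and A: "A \<in> sets F"
    and sR: "AE w in M. norm (s w) \<le> R" and mB: "AE w in M. norm (m w) \<le> B"
    and YB: "AE w in M. norm (Y w) \<le> B" and l01: "AE w in M. 0 < l w \<and> l w \<le> 4/5"
    and V0: "AE w in M. 0 \<le> V w"
    and c: "c = 1 / (4 * B)"
  shows "(\<integral>w. indicator A w * (cosh_norm D (s w + (c * l w) *\<^sub>R (Y w - \<mu>))
      * exp (- (V w + psi_E (l w) * (c * norm (Y w - m w))\<^sup>2))) \<partial>M)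
    \<le> (\<integral>w. indicator A w * (cosh_norm D (s w) * exp (- V w)) \<partial>M)"
proof -
  interpret prob_space M by fact
  have sub: "subalgebra M F" and Y: "integrable M Y" using ce by (auto simp: is_cond_exp_def)
  let ?d = "dir_deriv (cosh_norm D) :: 'a \<Rightarrow> 'a \<Rightarrow> real"
  have cpos: "c > 0" using B by (simp add: c)
  have cv: "convex_on UNIV (cosh_norm D :: 'a \<Rightarrow> real)" using D by (intro convex_on_cosh_norm) simp
  have YM: "Y \<in> borel_measurable M" using Y by simp
  note smlV = measurable_from_subalg[OF sub s] measurable_from_subalg[OF sub m]
    measurable_from_subalg[OF sub l] measurable_from_subalg[OF sub V]
  have AM: "A \<in> sets M" using A sub by (auto simp: subalgebra_def)
  define \<Phi> where "\<Phi> w = indicator A w * exp (- V w)" for w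
  have \<Phi>: "\<Phi> \<in> borel_measurable F"
    unfolding \<Phi>_def using A V by measurable
  define s' where "s' w = s w - (c * l w) *\<^sub>R (\<mu> - m w)" for w
  have s': "s' \<in> borel_measurable F"
    unfolding s'_def using s m l by measurable
  have lc: "c * l w \<le> c" if "l w \<le> 4/5" for w using that cpos by (simp add: mult_le_cancel_left2)
  have \<Phi>01: "0 \<le> \<Phi> w \<and> \<Phi> w \<le> 1" if "0 \<le> V w" for w
    using that by (auto simp: \<Phi>_def indicator_def)
  have nY\<mu>: "norm (Y w - \<mu>) \<le> B + norm \<mu>" if "norm (Y w) \<le> B" for w
    using norm_triangle_ineq4[of "Y w" \<mu>] that by simp
  \<comment> \<open>The conditionally centred part of the first-order term. Its base point
    \<open>s'\<close> and its weight are \<open>F\<close>-measurable and essentially bounded, so it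
    has mean 0.\<close>
  define r where "r w = \<Phi> w * (c * l w) * ?d (s' w) (Y w - \<mu>)" for w
  have r: "integrable M r" "(\<integral>w. r w \<partial>M) = 0"
  proof -
    have "AE w in M. norm (s' w) \<le> R + c * (norm \<mu> + B)"
      using sR mB l01
    proof eventually_elim
      case (elim w)
      have "norm (s' w) \<le> norm (s w) + c * l w * norm (\<mu> - m w)"
        using norm_triangle_ineq4[of "s w" "(c * l w) *\<^sub>R (\<mu> - m w)"] elim cpos
        by (simp add: s'_def abs_mult)
      also have "c * l w * norm (\<mu> - m w) \<le> c * (norm \<mu> + B)"
        using elim cpos lc[of w] norm_triangle_ineq4[of \<mu> "m w"] by (intro mult_mono) auto
      finally show ?case using elim by simp
    qed
    moreover have "AE w in M. \<bar>\<Phi> w * (c * l w)\<bar> \<le> 1 * c"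
      using l01 V0
    proof eventually_elim
      case (elim w)
      then show ?case using \<Phi>01[of w] lc[of w] cpos unfolding abs_mult by (intro mult_mono) auto
    qed
    moreover have "(\<lambda>w. \<Phi> w * (c * l w)) \<in> borel_measurable F"
      using \<Phi> l by measurable
    ultimately show "integrable M r" "(\<integral>w. r w \<partial>M) = 0"
      unfolding r_def
      using integral_dir_deriv_cosh_norm_eq_0[OF assms(1) ce sm D s' _ _ _ YB] by blast+
  qed
  have R1: "integrable M (\<lambda>w. \<Phi> w * cosh_norm D (s w))"
  proof (rule integrable_const_bound)
    show "AE w in M. norm (\<Phi> w * cosh_norm D (s w)) \<le> 1 * cosh (R / D)"
      using sR V0
    proof eventually_elim
      case (elim w)
      then show ?case using \<Phi>01[of w] D cosh_norm_pos[of D "s w"] unfolding norm_mult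
        by (intro mult_mono) (auto simp: abs_of_pos intro!: cosh_norm_mono)
    qed
    show "(\<lambda>w. \<Phi> w * cosh_norm D (s w)) \<in> borel_measurable M"
      using smlV(1) measurable_from_subalg[OF sub \<Phi>] by measurable
  qed
  let ?L = "\<lambda>w. indicator A w * (cosh_norm D (s w + (c * l w) *\<^sub>R (Y w - \<mu>))
      * exp (- (V w + psi_E (l w) * (c * norm (Y w - m w))\<^sup>2)))"
  have le: "AE w in M. 0 \<le> ?L w \<and> ?L w \<le> \<Phi> w * cosh_norm D (s w) + r w"
    using mB YB l01 V0
  proof eventually_elim
    case (elim w)
    define x k where "x = (c * l w) *\<^sub>R (Y w - m w)" and "k = c * norm (Y w - m w)"
    \<comment> \<open>Both points lie in the ball of radius \<open>B\<close>;
      \<open>c * (2 * B) = 1/2\<close> is what fixes the choice of \<open>c\<close>.\<close>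
    have "norm (Y w - m w) \<le> 2 * B" using norm_triangle_ineq4[of "Y w" "m w"] elim by simp
    then have "k \<le> c * (2 * B)" unfolding k_def using cpos by simp
    then have k: "0 \<le> k" "k \<le> 1/2" using cpos B by (auto simp: k_def c)
    have x: "norm x = l w * k" using elim cpos by (simp add: x_def k_def abs_mult)
    have s'x: "s w + (c * l w) *\<^sub>R (Y w - \<mu>) = s' w + x"
      by (simp add: s'_def x_def algebra_simps)
    have "cosh_norm D (s' w + x) * exp (- (psi_E (l w) * k\<^sup>2)) \<le> cosh_norm D (s' w) + ?d (s' w) x"
      using elim by (intro cosh_norm_add_mult_exp_psi_E_le sm D k x) auto
    also have "?d (s' w) x
        = ?d (s' w) ((c * l w) *\<^sub>R (\<mu> - m w) + (c * l w) *\<^sub>R (Y w - \<mu>))"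
      by (simp add: x_def algebra_simps)
    also have "\<dots> = ?d (s' w) ((c * l w) *\<^sub>R (\<mu> - m w)) + c * l w * ?d (s' w) (Y w - \<mu>)"
      using dir_deriv_cosh_norm_linear[OF sm D, of "s' w"] by (simp only: linear_add linear_scale real_scaleR_def)
    also have "cosh_norm D (s' w) + \<dots> \<le> cosh_norm D (s w) + c * l w * ?d (s' w) (Y w - \<mu>)"
      using dir_deriv_gradient_ineq[OF cv, of "s' w" "(c * l w) *\<^sub>R (\<mu> - m w)"] by (simp add: s'_def)
    finally have "\<Phi> w * (cosh_norm D (s' w + x) * exp (- (psi_E (l w) * k\<^sup>2)))
        \<le> \<Phi> w * (cosh_norm D (s w) + c * l w * ?d (s' w) (Y w - \<mu>))"
      using \<Phi>01[of w] elim by (intro mult_left_mono) auto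
    moreover have "?L w = \<Phi> w * (cosh_norm D (s' w + x) * exp (- (psi_E (l w) * k\<^sup>2)))"
      unfolding s'x k_def[symmetric] by (simp add: \<Phi>_def mult_exp_exp mult_ac)
    moreover have "0 \<le> ?L w" by (intro mult_nonneg_nonneg) (auto simp: less_imp_le cosh_norm_pos)
    ultimately show ?case by (simp add: r_def algebra_simps)
  qed
  have RI: "integrable M (\<lambda>w. \<Phi> w * cosh_norm D (s w) + r w)" using R1 r(1) by simp
  have "(\<integral>w. ?L w \<partial>M) \<le> (\<integral>w. \<Phi> w * cosh_norm D (s w) + r w \<partial>M)"
  proof (rule integral_mono_AE[OF _ RI])
    \<comment> \<open>The pointwise estimate itself provides the integrable majorant, as
      \<open>?L\<close> is nonnegative.\<close>
    show "integrable M ?L"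
    proof (rule Bochner_Integration.integrable_bound[OF RI])
      show "?L \<in> borel_measurable M"
        using smlV YM AM by measurable
      show "AE w in M. norm (?L w) \<le> norm (\<Phi> w * cosh_norm D (s w) + r w)"
        using le by eventually_elim (simp only: real_norm_def abs_of_nonneg, linarith)
    qed
    show "AE w in M. ?L w \<le> \<Phi> w * cosh_norm D (s w) + r w" using le by eventually_elim simp
  qed
  also have "\<dots> = (\<integral>w. \<Phi> w * cosh_norm D (s w) \<partial>M)" using R1 r by simp
  also have "\<dots> = (\<integral>w. indicator A w * (cosh_norm D (s w) * exp (- V w)) \<partial>M)"
    by (simp add: \<Phi>_def mult_ac)
  finally show ?thesis .
qed

section \<open>The natural filtration\<close>

lemma space_nat_filtration [simp]: "space (nat_filtration M X t) = space M"
  by (auto simp: nat_filtration_def intro!: space_measure_of)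

lemma sets_nat_filtration:
  "sets (nat_filtration M X t)
    = sigma_sets (space M) (\<Union>i\<in>{1..t}. {X i -` A \<inter> space M | A. A \<in> sets borel})"
  unfolding nat_filtration_def by (rule sets_measure_of) auto

lemma sets_nat_filtration_mono:
  "s \<le> t \<Longrightarrow> sets (nat_filtration M X s) \<subseteq> sets (nat_filtration M X t)"
  unfolding sets_nat_filtration by (intro sigma_sets_mono') fastforce

lemma measurable_nat_filtration_mono:
  "f \<in> borel_measurable (nat_filtration M X s) \<Longrightarrow> s \<le> t \<Longrightarrow>
    f \<in> borel_measurable (nat_filtration M X t)"
  using sets_nat_filtration_mono[of s t M X] by (auto simp: measurable_def)

lemma measurable_nat_filtration:
  assumes "1 \<le> i" "i \<le> t"
  shows "X i \<in> borel_measurable (nat_filtration M X t)"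
proof (rule measurableI)
  fix A :: "'b set" assume A: "A \<in> sets borel"
  have "X i -` A \<inter> space M \<in> (\<Union>i\<in>{1..t}. {X i -` A \<inter> space M | A. A \<in> sets borel})"
    using assms A by (intro UN_I[of i] CollectI exI[of _ A] conjI) auto
  then show "X i -` A \<inter> space (nat_filtration M X t) \<in> sets (nat_filtration M X t)"
    unfolding sets_nat_filtration space_nat_filtration by (rule sigma_sets.Basic)
qed simp

lemma measurable_running_mean:
  fixes X :: "nat \<Rightarrow> 'w \<Rightarrow> 'a::{banach, second_countable_topology}"
  assumes "\<And>j. 1 \<le> j \<Longrightarrow> j \<le> i \<Longrightarrow> X j \<in> borel_measurable F"
    and "\<And>j. 1 \<le> j \<Longrightarrow> j \<le> i \<Longrightarrow> lam j \<in> borel_measurable F"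
  shows "running_mean lam X i \<in> borel_measurable F"
  unfolding running_mean_def[abs_def]
  by (cases "i = 0") (use assms in \<open>auto intro!: borel_measurable_scaleR borel_measurable_sum borel_measurable_inverse\<close>)

text \<open>Positive weights make it a convex combination of points of the ball, and the default
  value 0 at index 0 lies in the ball as well.\<close>

lemma norm_running_mean_le:
  assumes "0 \<le> B" and "\<And>j. 1 \<le> j \<Longrightarrow> j \<le> i \<Longrightarrow> norm (X j w) \<le> B \<and> 0 < lam j w"
  shows "norm (running_mean lam X i w) \<le> B"
proof (cases "i = 0")
  case False
  have pos: "0 < (\<Sum>j=1..i. lam j w)" using False assms(2) by (intro sum_pos) auto
  have "norm (\<Sum>j=1..i. lam j w *\<^sub>R X j w) \<le> (\<Sum>j=1..i. lam j w * B)"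
    by (rule sum_norm_le) (use assms(2) in \<open>auto simp: less_imp_le intro!: mult_left_mono\<close>)
  also have "\<dots> = (\<Sum>j=1..i. lam j w) * B" by (simp add: sum_distrib_right)
  finally show ?thesis
    using pos False by (simp add: running_mean_def divideR_right[symmetric] field_simps)
qed (simp add: running_mean_def assms(1))

section \<open>The time-uniform deviation bound\<close>

theorem corollary1:
  fixes M :: "'w measure"
    and X :: "nat \<Rightarrow> 'w \<Rightarrow> 'a::{banach, second_countable_topology}"
    and lam :: "nat \<Rightarrow> 'w \<Rightarrow> real"
    and \<mu> :: 'a and B D \<alpha> :: real
  assumes "prob_space M"
    and "two_smooth TYPE('a) D"
    and "\<exists>x::'a. x \<noteq> 0"
    and "B > 0"
    and "\<And>t. t \<ge> 1 \<Longrightarrow> X t \<in> borel_measurable M"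
    and "\<And>t. is_cond_exp M (nat_filtration M X t) (X (t + 1)) (\<lambda>_. \<mu>)"
    and "\<And>t. t \<ge> 1 \<Longrightarrow> AE w in M. norm (X t w) \<le> B"
    and "predictable (nat_filtration M X) lam"
    and "\<And>t. t \<ge> 1 \<Longrightarrow> AE w in M. lam t w \<in> {0<..0.8}"
    and "0 < \<alpha>" "\<alpha> < 1"
  shows "measure M {w \<in> space M. \<forall>t\<ge>1.
      norm ((\<Sum>i=1..t. lam i w *\<^sub>R X i w) /\<^sub>R (\<Sum>i=1..t. lam i w) - \<mu>)
      \<le> D * ((1 / (4 * B) * (\<Sum>i=1..t. psi_E (lam i w) * (norm (X i w - running_mean lam X (i - 1) w))\<^sup>2)
             + 4 * B * ln (2 / \<alpha>))
            / (\<Sum>i=1..t. lam i w))} \<ge> 1 - \<alpha>"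
proof -
  interpret prob_space M by fact
  note sm = assms(2) and B = assms(4) and ce = assms(6)
  have D: "1 \<le> D" by (rule two_smooth_ge_1[OF sm assms(3)])
  define c where "c = 1 / (4 * B)"
  have c: "0 < c" using B by (simp add: c_def)
  define F where "F = nat_filtration M X"
  have sub: "subalgebra M (F t)" for t using ce[of t] by (simp add: F_def is_cond_exp_def)
  have XF: "X i \<in> borel_measurable (F t)" if "1 \<le> i" "i \<le> t" for i t
    unfolding F_def using that by (rule measurable_nat_filtration)
  \<comment> \<open>The range goes up to \<open>Suc t\<close>, one further than for
    \<open>X\<close>: predictability makes the next weight known at time \<open>t\<close>.\<close>
  have lF: "lam i \<in> borel_measurable (F t)" if "1 \<le> i" "i \<le> Suc t" for i t
    using assms(8) that unfolding F_def predictable_def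
    by (intro measurable_nat_filtration_mono[of "lam i" M X "i - 1" t]) auto
  have mF: "running_mean lam X i \<in> borel_measurable (F t)" if "i \<le> t" for i t
    using that by (intro measurable_running_mean XF lF) auto
  define S where "S t w = (\<Sum>i=1..t. (c * lam i w) *\<^sub>R (X i w - \<mu>))" for t w
  define V where "V t w = (\<Sum>i=1..t. psi_E (lam i w) * (c * norm (X i w - running_mean lam X (i - 1) w))\<^sup>2)" for t w
  define Z where "Z t w = cosh_norm D (S t w) * exp (- V t w)" for t w
  have SF: "S t \<in> borel_measurable (F t)" for t
    unfolding S_def[abs_def]
    by (intro borel_measurable_sum borel_measurable_scaleR borel_measurable_times
        borel_measurable_diff borel_measurable_const XF lF) auto
  have VF: "V t \<in> borel_measurable (F t)" for t
    unfolding V_def[abs_def]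
    by (intro borel_measurable_sum borel_measurable_times borel_measurable_power measurable_compose[OF _ borel_measurable_norm]
        borel_measurable_diff borel_measurable_const XF lF mF measurable_compose[OF _ borel_measurable_psi_E]) auto
  have ZF: "Z t \<in> borel_measurable (F t)" for t
    unfolding Z_def[abs_def] using SF[of t] VF[of t] by measurable
  \<comment> \<open>A single almost sure event carrying the bounds for all times at once; the
    pathwise estimates are made on it.\<close>
  define good where "good w \<longleftrightarrow> (\<forall>t\<ge>1. norm (X t w) \<le> B \<and> 0 < lam t w \<and> lam t w \<le> 4/5)" for w
  have good: "AE w in M. good w"
  proof -
    have "AE w in M. t \<ge> 1 \<longrightarrow> norm (X t w) \<le> B \<and> 0 < lam t w \<and> lam t w \<le> 4/5" for t
    proof (cases "t \<ge> 1")
      case True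
      from assms(7)[OF True] assms(9)[OF True] show ?thesis by eventually_elim auto
    qed simp
    then show ?thesis unfolding good_def by (simp add: AE_all_countable)
  qed
  have m_good: "norm (running_mean lam X t w) \<le> B" if "good w" for t w
    using that B by (intro norm_running_mean_le) (auto simp: good_def)
  have V_good: "0 \<le> V t w" if "good w" for t w
    unfolding V_def using that
    by (intro sum_nonneg mult_nonneg_nonneg psi_E_nonneg) (auto simp: good_def less_imp_le intro: le_less_trans)
  have S_good: "norm (S t w) \<le> real t * (c * (B + norm \<mu>))" if "good w" for t w
  proof -
    have "norm (S t w) \<le> (\<Sum>i=1..t. c * (B + norm \<mu>))"
      unfolding S_def
    proof (rule sum_norm_le)
      fix i assume i: "i \<in> {1..t}"
      have "norm (X i w - \<mu>) \<le> B + norm \<mu>"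
        using norm_triangle_ineq4[of "X i w" \<mu>] that i unfolding good_def by fastforce
      moreover have "\<bar>c * lam i w\<bar> \<le> c"
        using that i c unfolding good_def by (auto simp: abs_mult mult_le_cancel_left1 mult_le_cancel_left2)
      ultimately show "norm ((c * lam i w) *\<^sub>R (X i w - \<mu>)) \<le> c * (B + norm \<mu>)"
        unfolding norm_scaleR using c by (intro mult_mono) auto
    qed
    then show ?thesis by simp
  qed
  have Z_int: "integrable M (Z t)" for t
  proof (rule integrable_const_bound)
    show "AE w in M. norm (Z t w) \<le> cosh (real t * (c * (B + norm \<mu>)) / D) * 1"
      using good
    proof eventually_elim
      case (elim w)
      have "cosh_norm D (S t w) \<le> cosh (real t * (c * (B + norm \<mu>)) / D)"
        using D by (intro cosh_norm_mono S_good elim) simp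
      then show ?case
        unfolding Z_def norm_mult using V_good[OF elim, of t] cosh_norm_pos[of D "S t w"]
        by (intro mult_mono) auto
    qed
    show "Z t \<in> borel_measurable M" by (rule measurable_from_subalg[OF sub ZF])
  qed
  have step: "(\<integral>w. indicator A w * Z (Suc t) w \<partial>M) \<le> (\<integral>w. indicator A w * Z t w \<partial>M)"
    if A: "A \<in> sets (F t)" for A t
  proof -
    \<comment> \<open>The summand of \<open>V\<close> at index \<open>Suc t\<close> is centred at
      the running mean of index \<open>t\<close>, which is \<open>F t\<close>-measurable and so can
      serve as the predictor \<open>m\<close>.\<close>
    have "(\<integral>w. indicator A w * (cosh_norm D (S t w + (c * lam (Suc t) w) *\<^sub>R (X (Suc t) w - \<mu>))
        * exp (- (V t w + psi_E (lam (Suc t) w) * (c * norm (X (Suc t) w - running_mean lam X t w))\<^sup>2))) \<partial>M)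
      \<le> (\<integral>w. indicator A w * (cosh_norm D (S t w) * exp (- V t w)) \<partial>M)"
    proof (rule cosh_norm_supermartingale_step[OF assms(1) _ sm D B SF mF lF VF A _ _ _ _ _ c_def])
      show "is_cond_exp M (F t) (X (Suc t)) (\<lambda>_. \<mu>)" using ce[of t] by (simp add: F_def)
      show "AE w in M. norm (S t w) \<le> real t * (c * (B + norm \<mu>))"
        using good by eventually_elim (rule S_good)
      show "AE w in M. norm (running_mean lam X t w) \<le> B"
        using good by eventually_elim (rule m_good)
      show "AE w in M. norm (X (Suc t) w) \<le> B" "AE w in M. 0 < lam (Suc t) w \<and> lam (Suc t) w \<le> 4/5"
        using good by (eventually_elim, simp add: good_def)+
      show "AE w in M. 0 \<le> V t w" using good by eventually_elim (rule V_good)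
    qed auto
    then show ?thesis by (simp add: Z_def S_def V_def)
  qed
  \<comment> \<open>\<open>Z\<close> starts at mean 1, so crossing the level
    \<open>1 / \<alpha>\<close> has probability at most \<alpha>.\<close>
  have "measure M {w \<in> space M. \<exists>n. 1 / \<alpha> < Z n w} \<le> (\<integral>w. Z 0 w \<partial>M) / (1 / \<alpha>)"
  proof (rule supermartingale_maximal_ineq[where F = F and Z = Z, OF assms(1) sub _ ZF Z_int _ step])
    show "sets (F n) \<subseteq> sets (F (Suc n))" for n unfolding F_def by (rule sets_nat_filtration_mono) simp
    show "0 \<le> Z n w" for n w using cosh_norm_pos[of D "S n w"] by (simp add: Z_def)
  qed (use assms(10) in auto)
  also have "(\<integral>w. Z 0 w \<partial>M) = 1"
    by (simp add: Z_def S_def V_def cosh_norm_def prob_space)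
  finally have bad: "measure M {w \<in> space M. \<exists>n. 1 / \<alpha> < Z n w} \<le> \<alpha>" using assms(10) by simp
  have ZM: "Z t \<in> borel_measurable M" for t by (rule measurable_from_subalg[OF sub ZF])
  have bad_sets: "{w \<in> space M. \<exists>n. 1 / \<alpha> < Z n w} \<in> sets M" using ZM by measurable
  let ?P = "\<lambda>t w. norm ((\<Sum>i=1..t. lam i w *\<^sub>R X i w) /\<^sub>R (\<Sum>i=1..t. lam i w) - \<mu>)
      \<le> D * ((1 / (4 * B) * (\<Sum>i=1..t. psi_E (lam i w) * (norm (X i w - running_mean lam X (i - 1) w))\<^sup>2)
             + 4 * B * ln (2 / \<alpha>)) / (\<Sum>i=1..t. lam i w))"
  have P: "?P t w" if g: "good w" and Zt: "Z t w \<le> 1 / \<alpha>" and t: "1 \<le> t" for t w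
  proof -
    define L where "L = (\<Sum>i=1..t. lam i w)"
    define W where "W = (\<Sum>i=1..t. psi_E (lam i w) * (norm (X i w - running_mean lam X (i - 1) w))\<^sup>2)"
    have L: "0 < L" unfolding L_def using g t by (intro sum_pos) (auto simp: good_def)
    have VW: "V t w = c\<^sup>2 * W"
      by (simp add: V_def W_def power_mult_distrib sum_distrib_left mult_ac)
    define n where "n = norm ((\<Sum>i=1..t. lam i w *\<^sub>R X i w) /\<^sub>R L - \<mu>)"
    have "S t w = c *\<^sub>R ((\<Sum>i=1..t. lam i w *\<^sub>R X i w) - L *\<^sub>R \<mu>)"
      by (simp add: S_def L_def scaleR_sum_right scaleR_sum_left sum_subtractf[symmetric] scaleR_diff_right)
    also have "\<dots> = (c * L) *\<^sub>R ((\<Sum>i=1..t. lam i w *\<^sub>R X i w) /\<^sub>R L - \<mu>)"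
      using L by (simp add: scaleR_diff_right)
    finally have nS: "norm (S t w) = c * L * n" using c L by (simp add: n_def)
    \<comment> \<open>This trade of \<open>exp\<close> for \<open>2 * cosh\<close> is the source of
      the 2 in \<open>ln (2 / \<alpha>)\<close>.\<close>
    have "exp (norm (S t w) / D) \<le> 2 * cosh_norm D (S t w)"
      by (simp add: cosh_norm_def cosh_field_def)
    then have "exp (norm (S t w) / D - V t w) \<le> 2 * Z t w"
      by (simp add: Z_def exp_diff exp_minus divide_inverse)
    also have "\<dots> \<le> 2 / \<alpha>" using Zt by simp
    finally have "ln (exp (norm (S t w) / D - V t w)) \<le> ln (2 / \<alpha>)"
      using assms(10) by (subst ln_le_cancel_iff) auto
    then have "norm (S t w) / D \<le> c\<^sup>2 * W + ln (2 / \<alpha>)" by (simp add: VW)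
    then have "c * L * n \<le> D * (c\<^sup>2 * W + ln (2 / \<alpha>))"
      using D by (simp add: nS pos_divide_le_eq mult.commute)
    \<comment> \<open>Cancelling one \<open>c\<close> leaves a single power of it on the variance
      and turns \<open>1 / c\<close> into the factor \<open>4 * B\<close> on the logarithm.\<close>
    also have "\<dots> = c * (D * (c * W + 4 * B * ln (2 / \<alpha>)))"
      using B by (simp add: c_def power2_eq_square field_simps)
    finally have "L * n \<le> D * (c * W + 4 * B * ln (2 / \<alpha>))"
      using c by (simp add: mult.assoc)
    then have "n \<le> D * ((c * W + 4 * B * ln (2 / \<alpha>)) / L)"
      using L by (simp add: pos_le_divide_eq mult.commute)
    then show ?thesis by (simp only: n_def L_def W_def c_def)
  qed
  have lM: "lam i \<in> borel_measurable M" if "1 \<le> i" for i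
    using that by (intro measurable_from_subalg[OF sub lF[of i i]]) auto
  have mM: "running_mean lam X i \<in> borel_measurable M" for i
    by (rule measurable_from_subalg[OF sub mF[of i i]]) simp
  have "{w \<in> space M. ?P t w} \<in> sets M" for t
  proof -
    have gen: "{w \<in> space M. norm (f w /\<^sub>R g w - \<mu>) \<le> D * ((1 / (4 * B) * h w + C) / g w)} \<in> sets M"
      if [measurable]: "f \<in> borel_measurable M" "g \<in> borel_measurable M" "h \<in> borel_measurable M"
      for f :: "'w \<Rightarrow> 'a" and g h :: "'w \<Rightarrow> real" and C
      by measurable
    have 1: "(\<lambda>w. \<Sum>i=1..t. lam i w) \<in> borel_measurable M"
      by (intro borel_measurable_sum lM) auto
    have 2: "(\<lambda>w. \<Sum>i=1..t. lam i w *\<^sub>R X i w) \<in> borel_measurable M"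
      by (intro borel_measurable_sum borel_measurable_scaleR lM assms(5)) auto
    have 3: "(\<lambda>w. \<Sum>i=1..t. psi_E (lam i w) * (norm (X i w - running_mean lam X (i - 1) w))\<^sup>2) \<in> borel_measurable M"
      by (intro borel_measurable_sum borel_measurable_times borel_measurable_power measurable_compose[OF _ borel_measurable_norm]
        borel_measurable_diff assms(5) mM measurable_compose[OF lM borel_measurable_psi_E]) auto
    show ?thesis by (rule gen[OF 2 1 3])
  qed
  then have meas: "{w \<in> space M. \<forall>t\<ge>1. ?P t w} \<in> sets M"
    by (intro sets.sets_Collect_countable_All sets.sets_Collect_imp sets.sets_Collect_const)
  have "1 - \<alpha> \<le> measure M (space M - {w \<in> space M. \<exists>n. 1 / \<alpha> < Z n w})"
    using bad by (simp add: prob_compl[OF bad_sets])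
  also have "\<dots> \<le> measure M {w \<in> space M. \<forall>t\<ge>1. ?P t w}"
  \<comment> \<open>Staying below the level implies the bound only on the event \<open>good\<close>,
    so the inclusion of events holds almost surely.\<close>
  proof (rule finite_measure_mono_AE[OF _ meas])
    show "AE w in M. w \<in> space M - {w \<in> space M. \<exists>n. 1 / \<alpha> < Z n w}
        \<longrightarrow> w \<in> {w \<in> space M. \<forall>t\<ge>1. ?P t w}"
      using good
    proof eventually_elim
      case (elim w)
      show ?case
      proof (intro impI CollectI conjI allI)
        fix t :: nat assume w: "w \<in> space M - {w \<in> space M. \<exists>n. 1 / \<alpha> < Z n w}" and t: "1 \<le> t"
        from w have "Z t w \<le> 1 / \<alpha>" by (auto simp: not_less)
        then show "?P t w" using elim t by (intro P)
      qed auto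
    qed
  qed
  finally show ?thesis .
qed

end
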